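(* Fix a prime $p > 2$. Let $\#_{all}(n)$ be the number of all groups of order $p^n$ (up to isomorphism), and let $\#_{[G,G] \neq K(G)}(n)$ be the number of groups $G$ of order $p^n$ (up to isomorphism) in which not every element of the derived subgroup $[G,G]$ is a simple commutator. Then $$\lim_{n \to \infty} \frac{\log_p \#_{[G,G] \neq K(G)}(n)}{\log_p \#_{all}(n)} = 1.$$
   Context: A simple commutator in $G$ is an element of the form $[g,h] = g^{-1}h^{-1}gh$ with $g,h \in G$; $K(G)$ denotes the set of simple commutators of $G$. *)

theory Defs
  imports Complex_Main "HOL-Algebra.Algebra"
begin

definition simple_commutators :: "('a, 'b) monoid_scheme \<Rightarrow> 'a set" where
  "simple_commutators G =
     {inv\<^bsub>G\<^esub> g \<otimes>\<^bsub>G\<^esub> inv\<^bsub>G\<^esub> h \<otimes>\<^bsub>G\<^esub> g \<otimes>\<^bsub>G\<^esub> h | g h. g \<in> carrier G \<and> h \<in> carrier G}"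

text \<open>
  The library builds \<open>derived G (carrier G)\<close> from the products \<open>g h g\<inverse> h\<inverse>\<close>. As \<open>g\<close> and \<open>h\<close> run
  over all of \<open>G\<close> these are the same elements, so \<open>derived G (carrier G)\<close> is the subgroup generated
  by \<open>simple_commutators G\<close>.
\<close>

lemma (in group) simple_commutators_eq_derived_set:
  "simple_commutators G = derived_set G (carrier G)"
proof
  show "simple_commutators G \<subseteq> derived_set G (carrier G)"
  proof
    fix x assume "x \<in> simple_commutators G"
    then obtain g h where gh: "g \<in> carrier G" "h \<in> carrier G"
      and x: "x = inv g \<otimes> inv h \<otimes> g \<otimes> h"
      unfolding simple_commutators_def by blast
    have "x = inv g \<otimes> inv h \<otimes> inv (inv g) \<otimes> inv (inv h)"
      using gh x by simp
    then show "x \<in> derived_set G (carrier G)"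
      using gh by blast
  qed
next
  show "derived_set G (carrier G) \<subseteq> simple_commutators G"
  proof
    fix x assume "x \<in> derived_set G (carrier G)"
    then obtain g h where gh: "g \<in> carrier G" "h \<in> carrier G"
      and x: "x = g \<otimes> h \<otimes> inv g \<otimes> inv h"
      by blast
    have "x = inv (inv g) \<otimes> inv (inv h) \<otimes> inv g \<otimes> inv h"
      using gh x by simp
    then show "x \<in> simple_commutators G"
      using gh unfolding simple_commutators_def by blast
  qed
qed

lemma (in group) derived_eq_generate_simple_commutators:
  "derived G (carrier G) = generate G (simple_commutators G)"
  by (simp add: derived_def simple_commutators_eq_derived_set)

definition iso_rel :: "nat monoid set \<Rightarrow> (nat monoid \<times> nat monoid) set" where
  "iso_rel S = {(G, H). G \<in> S \<and> H \<in> S \<and> G \<cong> H}"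

text \<open>
  The number of groups of order \<open>m > 0\<close> with property \<open>P\<close>, up to isomorphism. Every finite group is
  isomorphic to one whose carrier is a set of natural numbers, so for an isomorphism-invariant \<open>P\<close>
  it suffices to count isomorphism classes among those.
\<close>

definition num_groups :: "(nat monoid \<Rightarrow> bool) \<Rightarrow> nat \<Rightarrow> nat" where
  "num_groups P m =
     (let S = {G. group G \<and> order G = m \<and> P G} in card (S // iso_rel S))"

lemma equiv_iso_rel:
  assumes "\<And>G. G \<in> S \<Longrightarrow> group G"
  shows "equiv S (iso_rel S)"
proof (rule equivI)
  show "iso_rel S \<subseteq> S \<times> S"
    by (auto simp: iso_rel_def)
  show "refl_on S (iso_rel S)"
    by (auto simp: iso_rel_def refl_on_def iso_refl)
  show "sym (iso_rel S)"
    by (auto simp: iso_rel_def sym_def assms group.iso_sym)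
  show "trans (iso_rel S)"
    unfolding iso_rel_def trans_def by (auto intro: iso_trans)
qed

definition num_all :: "nat \<Rightarrow> nat \<Rightarrow> nat" where
  "num_all p n = num_groups (\<lambda>G. True) (p ^ n)"

definition num_derived_not_commutators :: "nat \<Rightarrow> nat \<Rightarrow> nat" where
  "num_derived_not_commutators p n =
     num_groups (\<lambda>G. derived G (carrier G) \<noteq> simple_commutators G) (p ^ n)"

end

theory Submission
  imports Defs "HOL-Library.Countable_Set" "HOL-Number_Theory.Cong" "HOL-Real_Asymp.Real_Asymp"
begin

text \<open>
  Let \<open>a n\<close> and \<open>b n\<close> be the logarithms to base \<open>p\<close> of the numbers of all groups of order \<open>p ^ n\<close> and of those
  with a derived element that is no simple commutator. Clearly \<open>b n \<le> a n\<close>. The limit follows from two facts: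
  \<open>a n - b n\<close> is at most quadratic in \<open>n\<close>, and \<open>a n\<close> grows at least cubically.

  For the first fact, take one exceptional group \<open>K\<close> of order \<open>p ^ 10\<close>: vectors with four plus six coordinates
  modulo \<open>p\<close>, whose commutators are the pure wedges \<open>x \<and> y\<close> of vectors of length four, so that they satisfy the
  Pluecker relation, while products of commutators need not (\<open>pluecker_group_derived_neq\<close>). If \<open>H\<close> has order
  \<open>p ^ (n - 10)\<close>, then \<open>H \<times> K\<close> is exceptional of order \<open>p ^ n\<close>, since \<open>K\<close> is a quotient of it. A group \<open>G\<close>
  arises from few types \<open>H\<close>, because \<open>H\<close> is the quotient of \<open>G\<close> by the image of \<open>K\<close>, and there are only
  \<open>p ^ O(n)\<close> homomorphisms from \<open>K\<close> to \<open>G\<close> (\<open>num_all_le_num_derived_not_commutators\<close>). Hence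
  \<open>b n \<ge> a (n - 10) - O(n)\<close>.

  To return from \<open>n - 10\<close> to \<open>n\<close>, note that a group of order \<open>p ^ (n + 1)\<close> has a normal subgroup \<open>M\<close> of order
  \<open>p ^ n\<close>, and is determined by \<open>M\<close> together with the conjugation action on \<open>M\<close> and the \<open>p\<close>-th power of an
  element \<open>t\<close> outside \<open>M\<close>. The action is an automorphism of \<open>M\<close>, known from its values on \<open>O(n)\<close>
  generators, so there are \<open>p ^ O(n\<^sup>2)\<close> choices (\<open>num_all_Suc_le\<close>). Ten steps cost \<open>O(n\<^sup>2)\<close> in the logarithm.

  The second fact is Higman's: with \<open>r\<close> about \<open>n / 3\<close>, the bilinear maps from two spaces of dimension \<open>r\<close> to one
  of dimension \<open>n - 2 r\<close> define groups of order \<open>p ^ n\<close> and class at most two. There are \<open>p ^ (r\<^sup>2 (n - 2 r))\<close>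
  such maps, and since an isomorphism is known from its values on \<open>O(n)\<close> generators, each isomorphism type
  is hit only \<open>p ^ O(n\<^sup>2)\<close> times (\<open>power_le_num_all\<close>).
\<close>

section \<open>Counting groups up to isomorphism\<close>

definition groups_of :: "(nat monoid \<Rightarrow> bool) \<Rightarrow> nat \<Rightarrow> nat monoid set" where
  "groups_of P m = {G. group G \<and> order G = m \<and> P G}"

text \<open>
  Constructions are applied to representatives: a map between isomorphism classes then becomes a map
  between sets of groups, and its fibres can be counted there.
\<close>
definition iso_transversal :: "(nat monoid \<Rightarrow> bool) \<Rightarrow> nat \<Rightarrow> nat monoid set \<Rightarrow> bool" where
  "iso_transversal P m R \<longleftrightarrow> R \<subseteq> groups_of P m \<and>
     (\<forall>G\<in>R. \<forall>H\<in>R. G \<cong> H \<longrightarrow> G = H) \<and> (\<forall>G\<in>groups_of P m. \<exists>H\<in>R. G \<cong> H)"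

lemma equiv_groups_of: "equiv (groups_of P m) (iso_rel (groups_of P m))"
  by (rule equiv_iso_rel) (simp add: groups_of_def)

lemma iso_transversal_exists: "\<exists>R. iso_transversal P m R"
proof -
  let ?S = "groups_of P m" and ?E = "iso_rel (groups_of P m)"
  define rep where "rep C = (SOME G. G \<in> C)" for C :: "nat monoid set"
  have rep: "rep C \<in> C" if "C \<in> ?S // ?E" for C
    using in_quotient_imp_non_empty[OF equiv_groups_of that] by (auto simp: rep_def some_in_eq)
  have "iso_transversal P m (rep ` (?S // ?E))"
    unfolding iso_transversal_def
  proof (intro conjI ballI impI)
    show "rep ` (?S // ?E) \<subseteq> ?S"
      using rep in_quotient_imp_subset[OF equiv_groups_of] by blast
  next
    fix G H assume "G \<in> rep ` (?S // ?E)" "H \<in> rep ` (?S // ?E)" "G \<cong> H"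
    then obtain C D where C: "C \<in> ?S // ?E" "G = rep C" and D: "D \<in> ?S // ?E" "H = rep D"
      by blast
    have "G \<in> C" "H \<in> D" using C D rep by auto
    moreover from this have "(G, H) \<in> ?E"
      using C D \<open>G \<cong> H\<close> in_quotient_imp_subset[OF equiv_groups_of] by (auto simp: iso_rel_def)
    ultimately have "C = D" using C D quotient_eqI[OF equiv_groups_of] by blast
    then show "G = H" using C D by simp
  next
    fix G assume G: "G \<in> ?S"
    let ?C = "?E `` {G}"
    have C: "?C \<in> ?S // ?E" using G by (rule quotientI)
    then have "(G, rep ?C) \<in> ?E" using rep[OF C] by (simp only: Image_singleton_iff)
    then have "G \<cong> rep ?C" unfolding iso_rel_def by blast
    with C show "\<exists>H\<in>rep ` (?S // ?E). G \<cong> H" by blast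
  qed
  then show ?thesis by blast
qed

lemma card_iso_transversal:
  assumes "iso_transversal P m R"
  shows "card R = num_groups P m"
proof -
  let ?S = "groups_of P m" and ?E = "iso_rel (groups_of P m)"
  have "bij_betw (\<lambda>G. ?E `` {G}) R (?S // ?E)"
    unfolding bij_betw_def
  proof
    show "inj_on (\<lambda>G. ?E `` {G}) R"
    proof (rule inj_onI)
      fix G H assume GH: "G \<in> R" "H \<in> R" "?E `` {G} = ?E `` {H}"
      then have "(G, H) \<in> ?E"
        using assms eq_equiv_class[OF _ equiv_groups_of] by (auto simp: iso_transversal_def)
      then show "G = H" using assms GH by (auto simp: iso_transversal_def iso_rel_def)
    qed
    show "(\<lambda>G. ?E `` {G}) ` R = ?S // ?E"
    proof
      show "(\<lambda>G. ?E `` {G}) ` R \<subseteq> ?S // ?E"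
        using assms by (auto simp: iso_transversal_def intro!: quotientI)
      show "?S // ?E \<subseteq> (\<lambda>G. ?E `` {G}) ` R"
      proof
        fix C assume "C \<in> ?S // ?E"
        then obtain G where G: "G \<in> ?S" "C = ?E `` {G}" by (rule quotientE)
        then obtain H where H: "H \<in> R" "G \<cong> H" using assms by (auto simp: iso_transversal_def)
        then have "(G, H) \<in> ?E" using G assms by (auto simp: iso_transversal_def iso_rel_def)
        then have "C = ?E `` {H}" using G equiv_class_eq[OF equiv_groups_of] by blast
        then show "C \<in> (\<lambda>G. ?E `` {G}) ` R" using H by blast
      qed
    qed
  qed
  then show ?thesis
    unfolding num_groups_def Let_def groups_of_def by (rule bij_betw_same_card)
qed

lemma card_le_by_codes:
  assumes "inj_on f A" "f ` A \<subseteq> C" "finite C" "card C \<le> k"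
  shows "finite A \<and> card A \<le> k"
  using assms by (meson card_inj_on_le inj_on_finite le_trans)

text \<open>
  Every estimate in this development has this shape: the objects counted are sorted by the isomorphism
  type of an associated group, and the objects with a given type are injected into a small set of codes.
  The finiteness of \<open>I\<close> is part of the conclusion, because \<open>card\<close> is \<open>0\<close> on infinite sets.
\<close>
lemma card_le_by_fibres:
  assumes R: "finite R" and cover: "\<And>i. i \<in> I \<Longrightarrow> \<exists>r\<in>R. Q i r"
    and fibre: "\<And>r. r \<in> R \<Longrightarrow> finite {i\<in>I. Q i r} \<and> card {i\<in>I. Q i r} \<le> k"
  shows "finite I \<and> card I \<le> k * card R"
proof -
  have I: "I = (\<Union>r\<in>R. {i\<in>I. Q i r})" using cover by blast
  have "finite I" by (subst I) (use R fibre in auto)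
  moreover have "card I \<le> (\<Sum>r\<in>R. card {i\<in>I. Q i r})"
    by (subst I) (rule card_UN_le[OF R])
  moreover have "\<dots> \<le> (\<Sum>r\<in>R. k)" using fibre by (intro sum_mono) auto
  ultimately show ?thesis by (simp add: mult.commute)
qed

text \<open>
  The counting functions range over groups of natural numbers, so direct products and groups of integer
  vectors have to be transported there.
\<close>
definition nat_copy :: "('a, 'b) monoid_scheme \<Rightarrow> nat monoid" where
  "nat_copy G = image_group (to_nat_on (carrier G)) G"

lemma nat_copy:
  assumes "group G" and "finite (carrier G)"
  shows "G \<cong> nat_copy G" and "group (nat_copy G)" and "order (nat_copy G) = order G"
proof -
  have inj: "inj_on (to_nat_on (carrier G)) (carrier G)"
    using assms(2) by (simp add: inj_on_to_nat_on countable_finite)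
  show iso: "G \<cong> nat_copy G"
    using inj_imp_image_group_iso[OF inj] by (auto simp: nat_copy_def is_iso_def)
  show "group (nat_copy G)"
    using group.inj_imp_image_group_is_group[OF assms(1) inj] by (simp add: nat_copy_def)
  show "order (nat_copy G) = order G"
    using iso_same_card[OF iso] by (simp add: order_def)
qed

section \<open>Homomorphisms between finite groups\<close>

text \<open>
  Each new generator at least doubles the subgroup generated, so logarithmically many suffice. A set
  that is maximal among those satisfying the doubling bound must generate.
\<close>
lemma (in group) small_generating_set:
  assumes "finite (carrier G)"
  shows "\<exists>S \<subseteq> carrier G. generate G S = carrier G \<and> 2 ^ card S \<le> order G"
proof -
  define good where "good S \<longleftrightarrow> S \<subseteq> carrier G \<and> 2 ^ card S \<le> card (generate G S)" for S
  have fin: "finite {S. good S}"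
    by (rule finite_subset[of _ "Pow (carrier G)"]) (use assms in \<open>auto simp: good_def\<close>)
  have "good {}" using generate_empty by (simp add: good_def)
  then obtain S where S: "good S" and max: "\<And>T. good T \<Longrightarrow> \<not> S \<subset> T"
    using finite_has_maximal[OF fin] by (metis (no_types, lifting) empty_iff mem_Collect_eq psubset_eq)
  have sub: "S \<subseteq> carrier G" using S by (simp add: good_def)
  have genS: "subgroup (generate G S) G" using sub by (rule generate_is_subgroup)
  have "generate G S = carrier G"
  proof (rule ccontr)
    assume "generate G S \<noteq> carrier G"
    then obtain x where x: "x \<in> carrier G" "x \<notin> generate G S"
      using subgroup.subset[OF genS] by blast
    let ?T = "insert x S"
    have T: "?T \<subseteq> carrier G" using x sub by simp
    have genT: "subgroup (generate G ?T) G" using T by (rule generate_is_subgroup)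
    have le: "generate G S \<subseteq> generate G ?T" by (rule mono_generate) auto
    have xT: "x \<in> generate G ?T" by (rule generate.incl) simp
    have finT: "finite (generate G ?T)" using subgroup.subset[OF genT] assms finite_subset by blast
    \<comment> \<open>the subgroup generated by \<open>?T\<close> also contains a coset of the old one, disjoint from it\<close>
    have disj: "generate G S \<inter> (generate G S #> x) = {}"
    proof (rule ccontr)
      assume "generate G S \<inter> (generate G S #> x) \<noteq> {}"
      then obtain h where h: "h \<in> generate G S" "h \<otimes> x \<in> generate G S"
        by (auto simp: r_coset_def)
      have "h \<in> carrier G" using h subgroup.mem_carrier[OF genS] by blast
      then have "x = inv h \<otimes> (h \<otimes> x)" using x by (simp add: m_assoc[symmetric])
      also have "\<dots> \<in> generate G S" using h genS
        by (simp add: subgroup.m_closed subgroup.m_inv_closed)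
      finally show False using x by simp
    qed
    have cos: "generate G S #> x \<subseteq> generate G ?T"
      using le xT genT by (auto simp: r_coset_def intro: subgroup.m_closed)
    have "card (generate G S #> x) = card (generate G S)"
      using card_rcosets_equal[OF rcosetsI] subgroup.subset[OF genS] x by simp
    then have "2 * card (generate G S) = card (generate G S \<union> (generate G S #> x))"
      using disj finT le cos by (subst card_Un_disjoint) (auto intro: finite_subset)
    also have "\<dots> \<le> card (generate G ?T)"
      using le cos finT by (intro card_mono) auto
    finally have "2 * card (generate G S) \<le> card (generate G ?T)" .
    moreover have "x \<notin> S" using x generate.incl[of x S G] by blast
    moreover have "finite S" using sub assms finite_subset by blast
    ultimately have "good ?T" using S T by (simp add: good_def)
    then show False using max \<open>x \<notin> S\<close> by blast
  qed
  then show ?thesis using S by (auto simp: good_def order_def)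
qed

lemma hom_eq_on_generate:
  assumes f: "group_hom G H f" and g: "group_hom G H g" and S: "S \<subseteq> carrier G"
    and eq: "\<And>x. x \<in> S \<Longrightarrow> f x = g x" and x: "x \<in> generate G S"
  shows "f x = g x"
proof -
  interpret f: group_hom G H f by (rule f)
  interpret g: group_hom G H g by (rule g)
  show ?thesis using x
  proof (induction rule: generate.induct)
    case (eng h1 h2)
    then show ?case using f.G.generate_in_carrier[OF S] by simp
  qed (use eq S in auto)
qed

text \<open>
  Restriction to the carrier discards the arbitrary values elsewhere; only then is the set finite.
\<close>
definition restricted_homs :: "('a, 'c) monoid_scheme \<Rightarrow> ('b, 'd) monoid_scheme \<Rightarrow> ('a \<Rightarrow> 'b) set" where
  "restricted_homs G H = (\<lambda>f. restrict f (carrier G)) ` hom G H"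

text \<open>
  A homomorphism is determined by the images of at most \<open>d\<close> generators. With \<open>d\<close> proportional to
  \<open>log |G|\<close>, this makes the number of homomorphisms between groups of order at most \<open>p ^ n\<close> at most
  \<open>p\<close> to a power quadratic in \<open>n\<close>, which is negligible against the cubic growth of the logarithm of
  the number of groups.
\<close>
lemma card_restricted_homs:
  assumes G: "group G" and H: "group H" and fin: "finite (carrier G)" "finite (carrier H)"
    and le: "order G \<le> 2 ^ d"
  shows "finite (restricted_homs G H) \<and> card (restricted_homs G H) \<le> order H ^ d"
proof -
  obtain S where S: "S \<subseteq> carrier G" "generate G S = carrier G" "2 ^ card S \<le> order G"
    using group.small_generating_set[OF G fin(1)] by blast
  have finS: "finite S" using S fin finite_subset by blast
  have "(2::nat) ^ card S \<le> 2 ^ d" using S le by linarith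
  then have d: "card S \<le> d" by simp
  have "order H > 0" using H fin group.subgroup_self monoid.one_closed group.is_monoid
    by (metis card_gt_0_iff empty_iff order_def)
  show ?thesis
  proof (rule card_le_by_codes[where f = "\<lambda>f. restrict f S" and C = "S \<rightarrow>\<^sub>E carrier H"])
    show "inj_on (\<lambda>f. restrict f S) (restricted_homs G H)"
    proof (rule inj_onI)
      fix f g assume "f \<in> restricted_homs G H" "g \<in> restricted_homs G H"
        and eq: "restrict f S = restrict g S"
      then obtain f' g' where f': "f' \<in> hom G H" "f = restrict f' (carrier G)"
        and g': "g' \<in> hom G H" "g = restrict g' (carrier G)"
        by (auto simp: restricted_homs_def)
      have homs: "group_hom G H f'" "group_hom G H g'"
        using f' g' G H by (auto simp: group_hom_def group_hom_axioms_def)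
      have "f' x = g' x" if "x \<in> S" for x
        using that fun_cong[OF eq, of x] f' g' S by auto
      then have "f' x = g' x" if "x \<in> carrier G" for x
        using hom_eq_on_generate[OF homs S(1)] that S(2) by blast
      then show "f = g" using f' g' by (auto simp: restrict_def)
    qed
    show "(\<lambda>f. restrict f S) ` restricted_homs G H \<subseteq> S \<rightarrow>\<^sub>E carrier H"
      using S by (auto simp: restricted_homs_def hom_def Pi_iff subset_iff)
    show "finite (S \<rightarrow>\<^sub>E carrier H)" using finS fin by (simp add: finite_PiE)
    show "card (S \<rightarrow>\<^sub>E carrier H) \<le> order H ^ d"
      using d finS \<open>order H > 0\<close> by (simp add: card_funcsetE order_def power_increasing)
  qed
qed

section \<open>Subgroups of index p and cyclic extensions\<close>

text \<open>
  For \<open>g\<close> outside \<open>M\<close>, let \<open>M\<close> act on the \<open>p\<close> cosets of \<open>M\<close> by multiplication. The orbit of \<open>M g\<close> misses the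
  coset \<open>M\<close>, so it has fewer than \<open>p\<close> elements; its length divides the \<open>p\<close>-power \<open>|M|\<close>, so it is \<open>1\<close>,
  which says that \<open>g\<close> normalizes \<open>M\<close>. The proof works with the stabilizer \<open>K\<close> of \<open>M g\<close> directly.
\<close>
lemma (in group) index_prime_subgroup_normal:
  assumes p: "Factorial_Ring.prime p" and ord: "order G = p ^ Suc n"
    and M: "subgroup M G" "card M = p ^ n"
  shows "M \<lhd> G"
proof (rule normal_invI[OF M(1)])
  fix g h assume g: "g \<in> carrier G" and h: "h \<in> M"
  interpret M: subgroup M G by (rule M)
  have p0: "p > 0" using p by (rule prime_gt_0_nat)
  then have fin: "finite (carrier G)" using ord by (metis card_ge_0_finite order_def zero_less_power)
  then have finM: "finite M" using M.subset finite_subset by blast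
  show "g \<otimes> h \<otimes> inv g \<in> M"
  proof (cases "g \<in> M")
    case True
    then show ?thesis using h by simp
  next
    case False
    define K where "K = {h \<in> M. g \<otimes> h \<otimes> inv g \<in> M}"
    have conj_mult: "g \<otimes> (x \<otimes> y) \<otimes> inv g = (g \<otimes> x \<otimes> inv g) \<otimes> (g \<otimes> y \<otimes> inv g)"
      if "x \<in> carrier G" "y \<in> carrier G" for x y
      using that g by (simp add: m_assoc inv_solve_left)
    have conj_inv: "g \<otimes> inv x \<otimes> inv g = inv (g \<otimes> x \<otimes> inv g)" if "x \<in> carrier G" for x
      using that g by (simp add: m_assoc inv_mult_group)
    have KG: "subgroup K G"
    proof (rule subgroupI)
      show "K \<subseteq> carrier G" using M.subset by (auto simp: K_def)
      have "\<one> \<in> K" using g by (simp add: K_def)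
      then show "K \<noteq> {}" by blast
    qed (auto simp: K_def conj_mult conj_inv)
    define GM where "GM = G\<lparr>carrier := M\<rparr>"
    have "group GM" unfolding GM_def by (rule M.subgroup_is_group) (rule is_group)
    then interpret GM: group GM .
    have KM: "subgroup K GM"
      unfolding GM_def by (rule subgroup_incl[OF KG M(1)]) (auto simp: K_def)
    \<comment> \<open>\<open>K m \<mapsto> M g m\<close> embeds the cosets of \<open>K\<close> in \<open>M\<close> into the \<open>p - 1\<close> cosets of \<open>M\<close> other than \<open>M\<close>\<close>
    define c where "c = card (rcosets\<^bsub>GM\<^esub> K)"
    have c: "c * card K = p ^ n"
      using GM.lagrange[OF KM] M(2) by (simp add: c_def order_def GM_def)
    have "card (rcosets M) * p ^ n = p * p ^ n" using lagrange[OF M(1)] M(2) ord by simp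
    then have index: "card (rcosets M) = p" using p0 by simp
    have finr: "finite (rcosets M)" by (rule card_ge_0_finite) (use index p0 in simp)
    define rep where "rep C = (SOME x. x \<in> C)" for C :: "'a set"
    have rep: "rep C \<in> M \<and> C = K #>\<^bsub>GM\<^esub> rep C" if C: "C \<in> rcosets\<^bsub>GM\<^esub> K" for C
    proof -
      obtain x where x: "x \<in> carrier GM" "C = K #>\<^bsub>GM\<^esub> x" using C by (auto simp: RCOSETS_def)
      then have "x \<in> C" using GM.rcos_self KM by simp
      then have "rep C \<in> C" unfolding rep_def by (rule someI)
      moreover from this have "rep C \<in> M"
        using GM.r_coset_subset_G[OF subgroup.subset[OF KM] x(1)] x(2) by (auto simp: GM_def)
      ultimately show ?thesis using GM.repr_independence x KM by blast
    qed
    have "inj_on (\<lambda>C. M #> (g \<otimes> rep C)) (rcosets\<^bsub>GM\<^esub> K)"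
    proof (rule inj_onI)
      fix C D assume C: "C \<in> rcosets\<^bsub>GM\<^esub> K" and D: "D \<in> rcosets\<^bsub>GM\<^esub> K"
        and eq: "M #> (g \<otimes> rep C) = M #> (g \<otimes> rep D)"
      let ?x = "rep C" and ?y = "rep D"
      have x: "?x \<in> M" "?x \<in> carrier G" and y: "?y \<in> M" "?y \<in> carrier G" using rep C D M.subset by auto
      have "g \<otimes> ?x \<in> M #> (g \<otimes> ?y)" using eq rcos_self[of "g \<otimes> ?x" M] x g M by simp
      then have "(g \<otimes> ?x) \<otimes> inv (g \<otimes> ?y) \<in> M"
        using M.rcos_module_imp is_group g y by simp
      also have "(g \<otimes> ?x) \<otimes> inv (g \<otimes> ?y) = g \<otimes> (?x \<otimes> inv ?y) \<otimes> inv g"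
        using g x y by (simp add: inv_mult_group m_assoc)
      finally have "?x \<otimes> inv ?y \<in> K" using x y by (simp add: K_def)
      then have "?x \<otimes>\<^bsub>GM\<^esub> inv\<^bsub>GM\<^esub> ?y \<in> K" using y M m_inv_consistent by (simp add: GM_def)
      then have "?x \<in> K #>\<^bsub>GM\<^esub> ?y"
        using subgroup.rcos_module_rev[OF KM \<open>group GM\<close>, of ?y ?x] x y by (simp add: GM_def)
      then have "K #>\<^bsub>GM\<^esub> ?y = K #>\<^bsub>GM\<^esub> ?x"
        using GM.repr_independence KM y by (simp add: GM_def)
      then show "C = D" using rep C D by metis
    qed
    moreover have "(\<lambda>C. M #> (g \<otimes> rep C)) ` (rcosets\<^bsub>GM\<^esub> K) \<subseteq> rcosets M - {M}"
    proof clarify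
      fix C assume C: "C \<in> rcosets\<^bsub>GM\<^esub> K"
      have x: "rep C \<in> M" "rep C \<in> carrier G" using rep C M.subset by auto
      have "M #> (g \<otimes> rep C) \<noteq> M"
      proof
        assume "M #> (g \<otimes> rep C) = M"
        then have "g \<otimes> rep C \<in> M" using coset_join1 x g M by simp
        then have "(g \<otimes> rep C) \<otimes> inv (rep C) \<in> M" using x by simp
        then show False using False x g by (simp add: m_assoc)
      qed
      then show "M #> (g \<otimes> rep C) \<in> rcosets M - {M}"
        using x g M.subset by (simp add: rcosetsI)
    qed
    ultimately have "c \<le> card (rcosets M - {M})"
      unfolding c_def using finr by (intro card_inj_on_le) auto
    also have "\<dots> < p"
      using finr index M.subgroup_in_rcosets[OF is_group] p0 by (simp add: card_Diff_singleton)
    finally have "c < p" .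
    moreover obtain i where "c = p ^ i"
      using c p by (metis divides_primepow_nat dvd_triv_left)
    ultimately have "c = 1"
      using p0 power_increasing[of 1 i p] by (cases "i = 0") auto
    then have "card K = card M" using c M by simp
    moreover have "K \<subseteq> M" by (auto simp: K_def)
    ultimately have "K = M" using finM by (simp add: card_subset_eq)
    then have "h \<in> K" using h by simp
    then show ?thesis by (simp add: K_def)
  qed
qed

lemma normal_subgroup_of_index_prime:
  assumes p: "Factorial_Ring.prime p" and G: "group G" and ord: "order G = p ^ Suc n"
  shows "\<exists>M. M \<lhd> G \<and> card M = p ^ n"
proof -
  have "finite (carrier G)"
    using ord p by (metis card_ge_0_finite order_def prime_gt_0_nat zero_less_power)
  then obtain M where "subgroup M G" "card M = p ^ n"
    using sylow_thm[OF p G, of n p] ord by auto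
  then show ?thesis using group.index_prime_subgroup_normal[OF G p ord] by blast
qed

text \<open>
  For \<open>|G| = p |H|\<close> this says that \<open>G\<close> is an extension of an embedded copy \<open>\<phi> H\<close> of \<open>H\<close> by a cyclic group of
  order \<open>p\<close>, in which some \<open>t\<close> acts on \<open>\<phi> H\<close> as \<open>\<alpha>\<close> and has \<open>p\<close>-th power \<open>\<phi> m\<close>. The last condition makes the
  cosets of \<open>1, t, ..., t^(p - 1)\<close> distinct.
\<close>
definition cyclic_extension ::
  "nat \<Rightarrow> ('a, 'c) monoid_scheme \<Rightarrow> ('b, 'd) monoid_scheme \<Rightarrow> ('b \<Rightarrow> 'b) \<Rightarrow> 'b \<Rightarrow> bool" where
  "cyclic_extension p G H \<alpha> m \<longleftrightarrow> (\<exists>\<phi> t. \<phi> \<in> hom H G \<and> inj_on \<phi> (carrier H) \<and> t \<in> carrier G \<and>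
     \<phi> m = t [^]\<^bsub>G\<^esub> p \<and> (\<forall>x\<in>carrier H. \<phi> (\<alpha> x) = t \<otimes>\<^bsub>G\<^esub> \<phi> x \<otimes>\<^bsub>G\<^esub> inv\<^bsub>G\<^esub> t) \<and>
     (\<forall>i::nat. t [^]\<^bsub>G\<^esub> i \<in> \<phi> ` carrier H \<longrightarrow> p dvd i))"

text \<open>
  The product of \<open>x t^i\<close> and \<open>y t^j\<close> in normal form: moving \<open>t^i\<close> past \<open>y\<close> applies \<open>\<alpha>^i\<close>, and when the exponents
  add up to at least \<open>p\<close>, the factor \<open>t^p\<close> is replaced by \<open>m\<close>.
\<close>
definition cyclic_mult :: "nat \<Rightarrow> ('b, 'd) monoid_scheme \<Rightarrow> ('b \<Rightarrow> 'b) \<Rightarrow> 'b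
    \<Rightarrow> 'b \<times> nat \<Rightarrow> 'b \<times> nat \<Rightarrow> 'b \<times> nat" where
  "cyclic_mult p H \<alpha> m u v =
     (fst u \<otimes>\<^bsub>H\<^esub> (\<alpha> ^^ snd u) (fst v) \<otimes>\<^bsub>H\<^esub> (if snd u + snd v < p then \<one>\<^bsub>H\<^esub> else m),
      (snd u + snd v) mod p)"

text \<open>
  The map is \<open>(x, i) \<mapsto> \<phi> x t^i\<close>. It is injective because a power of \<open>t\<close> lies in the image of \<open>H\<close> only if \<open>p\<close>
  divides its exponent, and hence bijective by counting.
\<close>
lemma cyclic_extension_parametrization:
  assumes G: "group G" and H: "group H" and ext: "cyclic_extension p G H \<alpha> m"
    and ord: "order G = order H * p" and p: "p > 0" and fin: "finite (carrier G)"
    and \<alpha>: "\<alpha> \<in> carrier H \<rightarrow> carrier H" and m: "m \<in> carrier H"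
  shows "\<exists>\<psi>. bij_betw \<psi> (carrier H \<times> {..<p}) (carrier G) \<and>
    (\<forall>u\<in>carrier H \<times> {..<p}. \<forall>v\<in>carrier H \<times> {..<p}.
       cyclic_mult p H \<alpha> m u v \<in> carrier H \<times> {..<p} \<and>
       \<psi> (cyclic_mult p H \<alpha> m u v) = \<psi> u \<otimes>\<^bsub>G\<^esub> \<psi> v)"
proof -
  obtain \<phi> t where hom: "\<phi> \<in> hom H G" and inj: "inj_on \<phi> (carrier H)" and t: "t \<in> carrier G"
    and tp: "\<phi> m = t [^]\<^bsub>G\<^esub> p"
    and conj: "\<And>x. x \<in> carrier H \<Longrightarrow> \<phi> (\<alpha> x) = t \<otimes>\<^bsub>G\<^esub> \<phi> x \<otimes>\<^bsub>G\<^esub> inv\<^bsub>G\<^esub> t"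
    and per: "\<And>i::nat. t [^]\<^bsub>G\<^esub> i \<in> \<phi> ` carrier H \<Longrightarrow> p dvd i"
    using ext by (auto simp: cyclic_extension_def)
  interpret \<phi>: group_hom H G \<phi> using G H hom by (simp add: group_hom_def group_hom_axioms_def)
  define \<psi> where "\<psi> = (\<lambda>(x, i::nat). \<phi> x \<otimes>\<^bsub>G\<^esub> t [^]\<^bsub>G\<^esub> i)"
  let ?D = "carrier H \<times> {..<p}"
  have \<psi>_in: "\<psi> ` ?D \<subseteq> carrier G" using t by (auto simp: \<psi>_def)
  have inj_step: "x = y \<and> i = j"
    if xy: "x \<in> carrier H" "y \<in> carrier H" and ij: "i \<le> j" "j < p"
      and eq: "\<psi> (x, i) = \<psi> (y, j)" for x y i j
  proof -
    have "\<phi> x \<otimes>\<^bsub>G\<^esub> t [^]\<^bsub>G\<^esub> i = \<phi> y \<otimes>\<^bsub>G\<^esub> t [^]\<^bsub>G\<^esub> (j - i) \<otimes>\<^bsub>G\<^esub> t [^]\<^bsub>G\<^esub> i"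
      using eq ij t xy by (simp add: \<psi>_def \<phi>.H.m_assoc \<phi>.H.nat_pow_mult)
    then have eq': "\<phi> x = \<phi> y \<otimes>\<^bsub>G\<^esub> t [^]\<^bsub>G\<^esub> (j - i)"
      using t xy by simp
    then have "t [^]\<^bsub>G\<^esub> (j - i) = \<phi> (inv\<^bsub>H\<^esub> y \<otimes>\<^bsub>H\<^esub> x)"
      using t xy by (simp add: \<phi>.H.inv_solve_left)
    then have "p dvd j - i" using per xy by blast
    then have "i = j" using ij by (metis diff_diff_cancel dvd_imp_le diff_le_self le_antisym less_imp_diff_less
        nat_dvd_not_less neq0_conv diff_is_0_eq)
    then show ?thesis using eq' xy t inj by (simp add: inj_on_def)
  qed
  have inj\<psi>: "inj_on \<psi> ?D"
  proof (rule inj_onI)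
    fix u v assume uv: "u \<in> ?D" "v \<in> ?D" "\<psi> u = \<psi> v"
    show "u = v"
    proof (cases "snd u \<le> snd v")
      case True
      then show ?thesis using inj_step[of "fst u" "fst v" "snd u" "snd v"] uv by (auto simp: prod_eq_iff)
    next
      case False
      then show ?thesis using inj_step[of "fst v" "fst u" "snd v" "snd u"] uv by (auto simp: prod_eq_iff)
    qed
  qed
  have "card ?D = card (carrier G)" using ord by (simp add: order_def card_cartesian_product)
  then have bij: "bij_betw \<psi> ?D (carrier G)"
    using inj\<psi> \<psi>_in fin by (simp add: bij_betw_def card_image card_subset_eq)
  have pow: "(\<alpha> ^^ i) y \<in> carrier H \<and> \<phi> ((\<alpha> ^^ i) y) \<otimes>\<^bsub>G\<^esub> t [^]\<^bsub>G\<^esub> i = t [^]\<^bsub>G\<^esub> i \<otimes>\<^bsub>G\<^esub> \<phi> y"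
    if y: "y \<in> carrier H" for i y
  proof (induction i)
    case 0
    then show ?case using y by simp
  next
    case (Suc i)
    let ?y = "(\<alpha> ^^ i) y"
    have \<alpha>y: "\<alpha> ?y \<in> carrier H" using \<alpha> Suc by blast
    have "\<phi> (\<alpha> ?y) \<otimes>\<^bsub>G\<^esub> t = t \<otimes>\<^bsub>G\<^esub> \<phi> ?y"
      using conj Suc t by (simp add: \<phi>.H.m_assoc)
    have "\<phi> ((\<alpha> ^^ Suc i) y) \<otimes>\<^bsub>G\<^esub> t [^]\<^bsub>G\<^esub> Suc i = \<phi> (\<alpha> ?y) \<otimes>\<^bsub>G\<^esub> t \<otimes>\<^bsub>G\<^esub> t [^]\<^bsub>G\<^esub> i"
      using \<alpha>y t by (subst \<phi>.H.nat_pow_Suc2) (auto simp: \<phi>.H.m_assoc)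
    also have "\<dots> = t \<otimes>\<^bsub>G\<^esub> (\<phi> ?y \<otimes>\<^bsub>G\<^esub> t [^]\<^bsub>G\<^esub> i)"
      using Suc t \<open>\<phi> (\<alpha> ?y) \<otimes>\<^bsub>G\<^esub> t = t \<otimes>\<^bsub>G\<^esub> \<phi> ?y\<close> by (simp add: \<phi>.H.m_assoc)
    also have "\<dots> = t [^]\<^bsub>G\<^esub> Suc i \<otimes>\<^bsub>G\<^esub> \<phi> y"
      using Suc t y by (subst \<phi>.H.nat_pow_Suc2) (auto simp: \<phi>.H.m_assoc)
    finally show ?case using \<alpha>y by simp
  qed
  have wrap: "\<phi> (if i + j < p then \<one>\<^bsub>H\<^esub> else m) \<otimes>\<^bsub>G\<^esub> t [^]\<^bsub>G\<^esub> ((i + j) mod p) = t [^]\<^bsub>G\<^esub> (i + j)"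
    if "i < p" "j < p" for i j
  proof (cases "i + j < p")
    case False
    then have "(i + j) mod p = i + j - p" using that by (simp add: mod_if)
    then show ?thesis using False tp t by (simp add: \<phi>.H.nat_pow_mult)
  qed (use t in simp)
  have "cyclic_mult p H \<alpha> m u v \<in> ?D \<and> \<psi> (cyclic_mult p H \<alpha> m u v) = \<psi> u \<otimes>\<^bsub>G\<^esub> \<psi> v"
    if "u \<in> ?D" "v \<in> ?D" for u v
  proof -
    obtain x i y j where u: "u = (x, i)" and v: "v = (y, j)" by fastforce
    have x: "x \<in> carrier H" "y \<in> carrier H" "i < p" "j < p" using that u v by auto
    let ?e = "if i + j < p then \<one>\<^bsub>H\<^esub> else m"
    have e: "?e \<in> carrier H" using m by simp
    have "\<psi> (cyclic_mult p H \<alpha> m u v) =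
        \<phi> x \<otimes>\<^bsub>G\<^esub> \<phi> ((\<alpha> ^^ i) y) \<otimes>\<^bsub>G\<^esub> (\<phi> ?e \<otimes>\<^bsub>G\<^esub> t [^]\<^bsub>G\<^esub> ((i + j) mod p))"
      using x e t pow unfolding \<psi>_def cyclic_mult_def u v
      by (simp add: \<phi>.H.m_assoc del: if_split)
    also have "\<dots> = \<phi> x \<otimes>\<^bsub>G\<^esub> (\<phi> ((\<alpha> ^^ i) y) \<otimes>\<^bsub>G\<^esub> t [^]\<^bsub>G\<^esub> i) \<otimes>\<^bsub>G\<^esub> t [^]\<^bsub>G\<^esub> j"
      unfolding wrap[OF x(3,4)] using x(1,2) t conjunct1[OF pow[OF x(2), of i]]
      by (simp add: \<phi>.H.nat_pow_mult[symmetric] \<phi>.H.m_assoc)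
    also have "\<dots> = \<psi> u \<otimes>\<^bsub>G\<^esub> \<psi> v"
      using x t pow by (simp add: \<psi>_def u v \<phi>.H.m_assoc)
    finally show ?thesis using x e pow p by (auto simp: cyclic_mult_def u v)
  qed
  then show ?thesis using bij by blast
qed

text \<open>
  Both groups carry the multiplication \<open>cyclic_mult\<close>, which depends on \<open>\<alpha>\<close> and \<open>m\<close> only. So a group with a
  normal subgroup of index \<open>p\<close> is described by that subgroup, one of its automorphisms and one of its elements.
\<close>
lemma cyclic_extension_unique:
  assumes "group G" "group G'" "group H"
    and "cyclic_extension p G H \<alpha> m" "cyclic_extension p G' H \<alpha> m"
    and "order G = order H * p" "order G' = order H * p" and "p > 0"
    and "finite (carrier G)" "finite (carrier G')"
    and "\<alpha> \<in> carrier H \<rightarrow> carrier H" and "m \<in> carrier H"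
  shows "G \<cong> G'"
proof -
  let ?D = "carrier H \<times> {..<p}" and ?m = "cyclic_mult p H \<alpha> m"
  obtain \<psi> where \<psi>: "bij_betw \<psi> ?D (carrier G)"
    "\<And>u v. u \<in> ?D \<Longrightarrow> v \<in> ?D \<Longrightarrow> ?m u v \<in> ?D \<and> \<psi> (?m u v) = \<psi> u \<otimes>\<^bsub>G\<^esub> \<psi> v"
    using cyclic_extension_parametrization[of G H p \<alpha> m] assms by metis
  obtain \<psi>' where \<psi>': "bij_betw \<psi>' ?D (carrier G')"
    "\<And>u v. u \<in> ?D \<Longrightarrow> v \<in> ?D \<Longrightarrow> \<psi>' (?m u v) = \<psi>' u \<otimes>\<^bsub>G'\<^esub> \<psi>' v"
    using cyclic_extension_parametrization[of G' H p \<alpha> m] assms by metis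
  define \<theta> where "\<theta> = inv_into ?D \<psi>"
  have \<theta>: "bij_betw \<theta> (carrier G) ?D" unfolding \<theta>_def by (rule bij_betw_inv_into[OF \<psi>(1)])
  have \<theta>_in: "\<theta> x \<in> ?D" if "x \<in> carrier G" for x using \<theta> that by (rule bij_betw_apply)
  have \<theta>_mult: "\<theta> (x \<otimes>\<^bsub>G\<^esub> y) = ?m (\<theta> x) (\<theta> y)" if "x \<in> carrier G" "y \<in> carrier G" for x y
  proof -
    have "x \<otimes>\<^bsub>G\<^esub> y = \<psi> (?m (\<theta> x) (\<theta> y))"
      using \<psi> \<theta>_in that by (simp add: \<theta>_def bij_betw_inv_into_right)
    moreover have "?m (\<theta> x) (\<theta> y) \<in> ?D" using \<psi>(2) \<theta>_in that by blast
    ultimately show ?thesis using bij_betw_inv_into_left[OF \<psi>(1)] by (simp add: \<theta>_def)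
  qed
  have bij: "bij_betw (\<lambda>x. \<psi>' (\<theta> x)) (carrier G) (carrier G')"
    using bij_betw_trans[OF \<theta> \<psi>'(1)] by (simp add: comp_def)
  have "(\<lambda>x. \<psi>' (\<theta> x)) \<in> iso G G'"
    unfolding iso_def hom_def using bij bij_betw_apply[OF bij] \<psi>'(2) \<theta>_in \<theta>_mult by auto
  then show ?thesis by (auto simp: is_iso_def)
qed

text \<open>
  Any \<open>t\<close> outside \<open>M\<close> serves: its image generates the quotient, which has prime order \<open>p\<close>.
\<close>
lemma cyclic_extension_exists:
  assumes p: "Factorial_Ring.prime p" and G: "group G" and ord: "order G = p ^ Suc n"
    and M: "M \<lhd> G" "card M = p ^ n" and H: "group H" and iso: "G\<lparr>carrier := M\<rparr> \<cong> H"
  shows "\<exists>\<alpha>\<in>restricted_homs H H. \<exists>m\<in>carrier H. cyclic_extension p G H \<alpha> m"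
proof -
  interpret M: normal M G by (rule M)
  have MG: "subgroup M G" by (rule M.subgroup_axioms)
  have p0: "p > 0" using p by (rule prime_gt_0_nat)
  have fin: "finite (carrier G)" using ord p0 by (metis card_ge_0_finite order_def zero_less_power)
  have gM: "group (G\<lparr>carrier := M\<rparr>)" by (rule M.subgroup_is_group[OF G])
  have "H \<cong> G\<lparr>carrier := M\<rparr>" using group.iso_sym[OF gM iso] .
  then obtain \<phi> where iso\<phi>: "\<phi> \<in> iso H (G\<lparr>carrier := M\<rparr>)" by (auto simp: is_iso_def)
  have bij: "bij_betw \<phi> (carrier H) M" using iso\<phi> by (auto simp: iso_def)
  have \<phi>_in: "\<phi> x \<in> M" if "x \<in> carrier H" for x using bij that by (rule bij_betw_apply)
  have \<phi>_mult: "\<phi> (x \<otimes>\<^bsub>H\<^esub> y) = \<phi> x \<otimes>\<^bsub>G\<^esub> \<phi> y" if "x \<in> carrier H" "y \<in> carrier H" for x y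
    using iso\<phi> that by (auto simp: iso_def hom_def)
  have \<phi>_hom: "\<phi> \<in> hom H G" using \<phi>_in \<phi>_mult M.subset by (auto simp: hom_def)
  define \<theta> where "\<theta> = inv_into (carrier H) \<phi>"
  have \<theta>: "\<theta> y \<in> carrier H" "\<phi> (\<theta> y) = y" if "y \<in> M" for y
    using that bij by (auto simp: \<theta>_def bij_betw_inv_into_right bij_betw_imp_surj_on inv_into_into)
  have \<phi>_eqD: "x = y" if "\<phi> x = \<phi> y" "x \<in> carrier H" "y \<in> carrier H" for x y
    using bij that by (auto simp: bij_betw_def inj_on_def)
  have "card M < card (carrier G)" using M(2) ord prime_gt_1_nat[OF p] by (simp add: order_def)
  then obtain t where t: "t \<in> carrier G" "t \<notin> M" by (metis M.subset psubsetI psubset_imp_ex_mem less_irrefl DiffE)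
  let ?Q = "G Mod M"
  have Q: "group ?Q" by (rule M.factorgroup_is_group)
  interpret q: group_hom G ?Q "\<lambda>x. M #>\<^bsub>G\<^esub> x"
    using G Q M.r_coset_hom_Mod by (simp add: group_hom_def group_hom_axioms_def)
  have q_in: "M #>\<^bsub>G\<^esub> x = \<one>\<^bsub>?Q\<^esub> \<longleftrightarrow> x \<in> M" if "x \<in> carrier G" for x
    using that group.coset_join1[OF G _ that MG] group.coset_join2[OF G that MG] by (auto simp: FactGroup_def)
  have "card (rcosets\<^bsub>G\<^esub> M) * p ^ n = p * p ^ n" using group.lagrange[OF G MG] M(2) ord by simp
  then have oQ: "order ?Q = p" using p0 by (simp add: order_def FactGroup_def)
  have pow_in: "t [^]\<^bsub>G\<^esub> i \<in> M \<longleftrightarrow> p dvd i" for i :: nat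
  proof -
    let ?o = "group.ord ?Q (M #>\<^bsub>G\<^esub> t)"
    have ord_dvd: "t [^]\<^bsub>G\<^esub> j \<in> M \<longleftrightarrow> ?o dvd j" for j :: nat
    proof -
      have "t [^]\<^bsub>G\<^esub> j \<in> M \<longleftrightarrow> (M #>\<^bsub>G\<^esub> t) [^]\<^bsub>?Q\<^esub> j = \<one>\<^bsub>?Q\<^esub>"
        using q_in[of "t [^]\<^bsub>G\<^esub> j"] t by (simp add: q.hom_nat_pow[symmetric])
      also have "\<dots> \<longleftrightarrow> ?o dvd j" by (rule q.H.pow_eq_id) (use t q.hom_closed in blast)
      finally show ?thesis .
    qed
    have "?o = p"
    proof -
      have "?o dvd p" using q.H.ord_dvd_group_order[of "M #>\<^bsub>G\<^esub> t"] t oQ q.hom_closed by simp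
      moreover have "?o \<noteq> 1"
        using ord_dvd[of 1] t by auto
      ultimately show ?thesis using p by (metis prime_nat_iff)
    qed
    then show ?thesis using ord_dvd by simp
  qed
  define \<alpha> where "\<alpha> = restrict (\<lambda>x. \<theta> (t \<otimes>\<^bsub>G\<^esub> \<phi> x \<otimes>\<^bsub>G\<^esub> inv\<^bsub>G\<^esub> t)) (carrier H)"
  have conj_in: "t \<otimes>\<^bsub>G\<^esub> x \<otimes>\<^bsub>G\<^esub> inv\<^bsub>G\<^esub> t \<in> M" if "x \<in> M" for x
    using M.inv_op_closed2[OF t(1) that] .
  have \<alpha>: "\<alpha> x \<in> carrier H" "\<phi> (\<alpha> x) = t \<otimes>\<^bsub>G\<^esub> \<phi> x \<otimes>\<^bsub>G\<^esub> inv\<^bsub>G\<^esub> t" if "x \<in> carrier H" for x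
    using \<theta>[OF conj_in[OF \<phi>_in[OF that]]] that by (auto simp: \<alpha>_def)
  have \<alpha>_mult: "\<alpha> (x \<otimes>\<^bsub>H\<^esub> y) = \<alpha> x \<otimes>\<^bsub>H\<^esub> \<alpha> y" if xy: "x \<in> carrier H" "y \<in> carrier H" for x y
  proof (rule \<phi>_eqD)
    have G': "\<phi> x \<in> carrier G" "\<phi> y \<in> carrier G" using \<phi>_in xy M.subset by auto
    have xyH: "x \<otimes>\<^bsub>H\<^esub> y \<in> carrier H" using H xy by (simp add: group.is_monoid monoid.m_closed)
    show "\<alpha> (x \<otimes>\<^bsub>H\<^esub> y) \<in> carrier H" using \<alpha> xyH by blast
    show "\<alpha> x \<otimes>\<^bsub>H\<^esub> \<alpha> y \<in> carrier H" using \<alpha> xy H by (simp add: group.is_monoid monoid.m_closed)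
    show "\<phi> (\<alpha> (x \<otimes>\<^bsub>H\<^esub> y)) = \<phi> (\<alpha> x \<otimes>\<^bsub>H\<^esub> \<alpha> y)"
      using \<alpha> xyH xy \<phi>_mult G' t(1) by (simp add: M.m_assoc M.inv_solve_left)
  qed
  have "\<alpha> \<in> hom H H" using \<alpha> \<alpha>_mult by (auto simp: hom_def)
  then have "\<alpha> \<in> restricted_homs H H"
    unfolding restricted_homs_def by (intro image_eqI[of _ _ \<alpha>]) (auto simp: \<alpha>_def)
  moreover have tp: "t [^]\<^bsub>G\<^esub> p \<in> M" using pow_in by simp
  moreover have "cyclic_extension p G H \<alpha> (\<theta> (t [^]\<^bsub>G\<^esub> p))"
    unfolding cyclic_extension_def
    using \<phi>_hom bij t(1) \<theta>(2)[OF tp] \<alpha>(2) pow_in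
    by (intro exI[of _ \<phi>] exI[of _ t]) (auto simp: bij_betw_def)
  ultimately show ?thesis using \<theta>(1) by blast
qed

section \<open>Comparing the orders p^n and p^(n+1)\<close>

lemma finite_carrier_of_order: "order G > 0 \<Longrightarrow> finite (carrier G)"
  by (simp add: order_def card_ge_0_finite)

text \<open>
  Numbers of generators are bounded by logarithms to base two; this turns them into multiples of \<open>n\<close>.
\<close>
lemma prime_power_le_power2: "(p::nat) ^ n \<le> 2 ^ (p * n)"
proof -
  have "p ^ n \<le> (2 ^ p) ^ n" by (rule power_mono) (auto intro: less_imp_le less_exp)
  then show ?thesis by (simp add: power_mult)
qed

text \<open>
  Send a group of order \<open>p ^ (n + 1)\<close> to a normal subgroup \<open>H\<close> of index \<open>p\<close>. By the uniqueness of cyclic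
  extensions a fibre has at most as many elements as there are pairs \<open>(\<alpha>, m)\<close>: at most \<open>p ^ (n * (p * n))\<close>
  endomorphisms \<open>\<alpha>\<close> of \<open>H\<close>, because \<open>H\<close> needs no more than \<open>p * n\<close> generators, and \<open>p ^ n\<close> elements \<open>m\<close>.
\<close>
lemma transversal_extension_step:
  assumes p: "Factorial_Ring.prime p" and R': "iso_transversal (\<lambda>_. True) (p ^ n) R'" "finite R'"
    and R: "iso_transversal (\<lambda>_. True) (p ^ Suc n) R"
  shows "finite R \<and> card R \<le> p ^ (n * (p * n) + n) * card R'"
proof -
  have p0: "p > 0" using p by (rule prime_gt_0_nat)
  have R_group: "group G" "order G = p ^ Suc n" if "G \<in> R" for G
    using R that by (auto simp: iso_transversal_def groups_of_def)
  have "\<forall>G\<in>R. \<exists>M. M \<lhd> G \<and> card M = p ^ n"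
    using normal_subgroup_of_index_prime[OF p] R_group by blast
  from bchoice[OF this] obtain M where M: "\<And>G. G \<in> R \<Longrightarrow> M G \<lhd> G \<and> card (M G) = p ^ n"
    by blast
  show ?thesis
  proof (rule card_le_by_fibres[where Q = "\<lambda>G H. G\<lparr>carrier := M G\<rparr> \<cong> H"])
    show "finite R'" by (rule R'(2))
  next
    fix G assume G: "G \<in> R"
    have "subgroup (M G) G" using M[OF G] normal_imp_subgroup by blast
    then have "group (G\<lparr>carrier := M G\<rparr>)" using R_group(1)[OF G] by (rule subgroup.subgroup_is_group)
    then have "G\<lparr>carrier := M G\<rparr> \<in> groups_of (\<lambda>_. True) (p ^ n)"
      using M[OF G] by (simp add: groups_of_def order_def)
    then show "\<exists>H\<in>R'. G\<lparr>carrier := M G\<rparr> \<cong> H" using R'(1) by (simp add: iso_transversal_def)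
  next
    fix H assume H: "H \<in> R'"
    then have gH: "group H" and oH: "order H = p ^ n"
      using R' by (auto simp: iso_transversal_def groups_of_def)
    have finH: "finite (carrier H)" using oH p0 finite_carrier_of_order[of H] by simp
    let ?I = "{G \<in> R. G\<lparr>carrier := M G\<rparr> \<cong> H}"
    let ?C = "restricted_homs H H \<times> carrier H"
    have "\<forall>G\<in>?I. \<exists>c. c \<in> ?C \<and> cyclic_extension p G H (fst c) (snd c)"
    proof
      fix G assume "G \<in> ?I"
      then have G: "G \<in> R" "G\<lparr>carrier := M G\<rparr> \<cong> H" by auto
      obtain \<alpha> m where "\<alpha> \<in> restricted_homs H H" "m \<in> carrier H" "cyclic_extension p G H \<alpha> m"
        using cyclic_extension_exists[OF p R_group[OF G(1)] _ _ gH G(2)] M[OF G(1)] by blast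
      then show "\<exists>c. c \<in> ?C \<and> cyclic_extension p G H (fst c) (snd c)"
        by (intro exI[of _ "(\<alpha>, m)"]) simp
    qed
    from bchoice[OF this] obtain c
      where c: "\<And>G. G \<in> ?I \<Longrightarrow> c G \<in> ?C \<and> cyclic_extension p G H (fst (c G)) (snd (c G))"
      by blast
    have homs: "finite (restricted_homs H H)" "card (restricted_homs H H) \<le> (p ^ n) ^ (p * n)"
      using card_restricted_homs[OF gH gH finH finH] prime_power_le_power2 oH by auto
    show "finite ?I \<and> card ?I \<le> p ^ (n * (p * n) + n)"
    proof (rule card_le_by_codes[where f = c and C = ?C])
      show "c ` ?I \<subseteq> ?C" using c by blast
      show "inj_on c ?I"
      proof (rule inj_onI)
        fix G G' assume G: "G \<in> ?I" "G' \<in> ?I" "c G = c G'"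
        obtain \<alpha> m where cG: "c G = (\<alpha>, m)" by fastforce
        then have "\<alpha> \<in> restricted_homs H H" "m \<in> carrier H" using c[OF G(1)] by auto
        moreover from this have "\<alpha> \<in> carrier H \<rightarrow> carrier H" by (auto simp: restricted_homs_def hom_def)
        moreover have "cyclic_extension p G H \<alpha> m" "cyclic_extension p G' H \<alpha> m"
          using c[OF G(1)] c[OF G(2)] G(3) cG by auto
        moreover have "group G" "group G'" "order G = order H * p" "order G' = order H * p"
          using R_group G oH by auto
        moreover from this have "finite (carrier G)" "finite (carrier G')"
          using finite_carrier_of_order[of G] finite_carrier_of_order[of G'] oH p0 by auto
        ultimately have "G \<cong> G'" by (intro cyclic_extension_unique[OF _ _ gH, of G G' p \<alpha> m] p0)
        then show "G = G'" using R G by (auto simp: iso_transversal_def)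
      qed
      show "finite ?C" using homs finH by simp
      have "card ?C \<le> (p ^ n) ^ (p * n) * p ^ n"
        using homs oH by (simp add: card_cartesian_product order_def)
      then show "card ?C \<le> p ^ (n * (p * n) + n)" by (simp add: power_mult[symmetric] power_add)
    qed
  qed
qed

lemma carrier_of_order_1:
  assumes "group G" "order G = 1"
  shows "carrier G = {\<one>\<^bsub>G\<^esub>}"
proof -
  obtain a where "carrier G = {a}" using assms(2) by (auto simp: order_def card_1_singleton_iff)
  then show ?thesis using monoid.one_closed[OF group.is_monoid[OF assms(1)]] by auto
qed

lemma iso_of_order_1:
  assumes "group G" "group H" "order G = 1" "order H = 1"
  shows "G \<cong> H"
proof -
  have G: "carrier G = {\<one>\<^bsub>G\<^esub>}" and H: "carrier H = {\<one>\<^bsub>H\<^esub>}"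
    using assms carrier_of_order_1 by blast+
  have "(\<lambda>_. \<one>\<^bsub>H\<^esub>) \<in> iso G H"
    using assms(1,2) by (auto simp: iso_def hom_def bij_betw_def G H group.is_monoid monoid.l_one)
  then show ?thesis by (auto simp: is_iso_def)
qed

text \<open>
  The extension step also yields finiteness, starting from the trivial group.
\<close>
lemma finite_transversal:
  assumes p: "Factorial_Ring.prime p" and "iso_transversal (\<lambda>_. True) (p ^ n) R"
  shows "finite R"
  using assms(2)
proof (induction n arbitrary: R)
  case 0
  then have grp: "group G \<and> order G = 1" if "G \<in> R" for G
    using that by (auto simp: iso_transversal_def groups_of_def)
  have "G = H" if "G \<in> R" "H \<in> R" for G H
    using that iso_of_order_1 grp 0 unfolding iso_transversal_def by blast
  then have "R = {} \<or> (\<exists>G. R = {G})" by blast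
  then show ?case by auto
next
  case (Suc n)
  obtain R' where "iso_transversal (\<lambda>_. True) (p ^ n) R'" using iso_transversal_exists by blast
  then show ?case using Suc transversal_extension_step[OF p] by blast
qed

lemma card_transversal_mono:
  assumes R: "iso_transversal (\<lambda>_. True) m R" "finite R" and R': "iso_transversal P m R'"
  shows "finite R' \<and> card R' \<le> card R"
proof -
  have "finite R' \<and> card R' \<le> 1 * card R"
  proof (rule card_le_by_fibres[OF R(2), where Q = "\<lambda>G H. G \<cong> H"])
    show "\<exists>H\<in>R. G \<cong> H" if "G \<in> R'" for G
      using that R R' by (auto simp: iso_transversal_def groups_of_def)
  next
    fix H assume H: "H \<in> R"
    have "G = G'" if "G \<in> R'" "G' \<in> R'" "G \<cong> H" "G' \<cong> H" for G G'
    proof -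
      have "group G'" using that R' by (auto simp: iso_transversal_def groups_of_def)
      then have "G \<cong> G'" using iso_trans[OF that(3) group.iso_sym[OF _ that(4)]] by blast
      then show ?thesis using that(1,2) R' unfolding iso_transversal_def by blast
    qed
    then have "{G \<in> R'. G \<cong> H} = {} \<or> (\<exists>G. {G \<in> R'. G \<cong> H} = {G})" by blast
    then show "finite {G \<in> R'. G \<cong> H} \<and> card {G \<in> R'. G \<cong> H} \<le> 1"
    proof
      assume none: "{G \<in> R'. G \<cong> H} = {}"
      show ?thesis unfolding none by simp
    next
      assume "\<exists>G. {G \<in> R'. G \<cong> H} = {G}"
      then obtain G where one: "{G \<in> R'. G \<cong> H} = {G}" by blast
      show ?thesis unfolding one by simp
    qed
  qed
  then show ?thesis by simp
qed

lemma num_all_Suc_le: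
  assumes p: "Factorial_Ring.prime p"
  shows "num_all p (Suc n) \<le> p ^ (n * (p * n) + n) * num_all p n"
proof -
  obtain R R' where R: "iso_transversal (\<lambda>_. True) (p ^ Suc n) R" "iso_transversal (\<lambda>_. True) (p ^ n) R'"
    using iso_transversal_exists by blast
  then show ?thesis
    using transversal_extension_step[OF p R(2) _ R(1)] finite_transversal[OF p] card_iso_transversal[OF R(1)] card_iso_transversal[OF R(2)]
    by (simp add: num_all_def)
qed

section \<open>Multiplying by a fixed group\<close>

text \<open>
  A surjective homomorphism maps the derived subgroup onto the derived subgroup and simple commutators to
  simple commutators. So a derived element of \<open>K\<close> that is no simple commutator lifts to one of \<open>G\<close>.
\<close>
lemma derived_neq_simple_commutators_lift:
  assumes f: "group_hom G K f" and surj: "f ` carrier G = carrier K"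
    and K: "derived K (carrier K) \<noteq> simple_commutators K"
  shows "derived G (carrier G) \<noteq> simple_commutators G"
proof
  interpret f: group_hom G K f by (rule f)
  assume eq: "derived G (carrier G) = simple_commutators G"
  have "derived K (carrier K) = f ` derived G (carrier G)"
    using f.derived_img[of "carrier G"] surj by simp
  also have "\<dots> = f ` simple_commutators G" by (simp add: eq)
  also have "\<dots> \<subseteq> simple_commutators K" by (force simp: simple_commutators_def)
  finally show False
    using K generate.incl[of _ "simple_commutators K" K]
    by (auto simp: f.H.derived_eq_generate_simple_commutators)
qed

text \<open>
  The common image of \<open>1 \<times> K\<close> is a normal subgroup \<open>N\<close> of \<open>G\<close>, and \<open>H \<cong> G / N \<cong> H'\<close>. The isomorphism is
  written down as \<open>h \<mapsto> fst (\<phi>'\<inverse> (\<phi> (h, 1)))\<close>, so that no quotient has to be formed.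
\<close>
lemma iso_of_product_quotients:
  assumes G: "group G" and H: "group H" "finite (carrier H)" and H': "group H'" "finite (carrier H')"
    and K: "group K" and ord: "order H = order H'"
    and \<phi>: "\<phi> \<in> iso (H \<times>\<times> K) G" and \<phi>': "\<phi>' \<in> iso (H' \<times>\<times> K) G"
    and eq: "\<And>k. k \<in> carrier K \<Longrightarrow> \<phi> (\<one>\<^bsub>H\<^esub>, k) = \<phi>' (\<one>\<^bsub>H'\<^esub>, k)"
  shows "H \<cong> H'"
proof -
  have P: "group (H \<times>\<times> K)" "group (H' \<times>\<times> K)" using H H' K by (auto intro: DirProd_group)
  define \<theta> where "\<theta> = inv_into (carrier (H' \<times>\<times> K)) \<phi>'"
  have \<theta>: "\<theta> \<in> iso G (H' \<times>\<times> K)" unfolding \<theta>_def by (rule group.iso_set_sym[OF P(2) \<phi>'])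
  define f where "f h = fst (\<theta> (\<phi> (h, \<one>\<^bsub>K\<^esub>)))" for h
  interpret \<phi>: group_hom "H \<times>\<times> K" G \<phi>
    using \<phi> P G by (auto simp: group_hom_def group_hom_axioms_def iso_def)
  interpret \<theta>: group_hom G "H' \<times>\<times> K" \<theta>
    using \<theta> P G by (auto simp: group_hom_def group_hom_axioms_def iso_def)
  have KH: "\<one>\<^bsub>K\<^esub> \<in> carrier K" "\<one>\<^bsub>H\<^esub> \<in> carrier H" "\<one>\<^bsub>K\<^esub> \<otimes>\<^bsub>K\<^esub> \<one>\<^bsub>K\<^esub> = \<one>\<^bsub>K\<^esub>" "\<one>\<^bsub>H'\<^esub> \<in> carrier H'"
    using K H H' by (simp_all add: group.is_monoid monoid.one_closed monoid.l_one)
  have f_in: "f h \<in> carrier H'" if "h \<in> carrier H" for h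
  proof -
    have "\<phi> (h, \<one>\<^bsub>K\<^esub>) \<in> carrier G" using that KH by simp
    then have "\<theta> (\<phi> (h, \<one>\<^bsub>K\<^esub>)) \<in> carrier (H' \<times>\<times> K)" by (rule \<theta>.hom_closed)
    then show ?thesis by (auto simp: f_def DirProd_def)
  qed
  have f_mult: "f (x \<otimes>\<^bsub>H\<^esub> y) = f x \<otimes>\<^bsub>H'\<^esub> f y" if "x \<in> carrier H" "y \<in> carrier H" for x y
  proof -
    have xy: "(x \<otimes>\<^bsub>H\<^esub> y, \<one>\<^bsub>K\<^esub>) = (x, \<one>\<^bsub>K\<^esub>) \<otimes>\<^bsub>H \<times>\<times> K\<^esub> (y, \<one>\<^bsub>K\<^esub>)" using KH by simp
    have x: "(x, \<one>\<^bsub>K\<^esub>) \<in> carrier (H \<times>\<times> K)" and y: "(y, \<one>\<^bsub>K\<^esub>) \<in> carrier (H \<times>\<times> K)"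
      using that KH by simp_all
    have "\<theta> (\<phi> (x \<otimes>\<^bsub>H\<^esub> y, \<one>\<^bsub>K\<^esub>)) = \<theta> (\<phi> (x, \<one>\<^bsub>K\<^esub>)) \<otimes>\<^bsub>H' \<times>\<times> K\<^esub> \<theta> (\<phi> (y, \<one>\<^bsub>K\<^esub>))"
      unfolding xy \<phi>.hom_mult[OF x y] by (rule \<theta>.hom_mult[OF \<phi>.hom_closed[OF x] \<phi>.hom_closed[OF y]])
    then show ?thesis by (simp add: f_def DirProd_def split_beta)
  qed
  interpret f: group_hom H H' f
    using f_in f_mult H H' by (auto simp: group_hom_def group_hom_axioms_def hom_def)
  have "h = \<one>\<^bsub>H\<^esub>" if h: "h \<in> carrier H" and fh: "f h = \<one>\<^bsub>H'\<^esub>" for h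
  proof -
    have in_G: "\<phi> (h, \<one>\<^bsub>K\<^esub>) \<in> carrier G" using h KH by simp
    define k where "k = snd (\<theta> (\<phi> (h, \<one>\<^bsub>K\<^esub>)))"
    have \<theta>h: "\<theta> (\<phi> (h, \<one>\<^bsub>K\<^esub>)) = (\<one>\<^bsub>H'\<^esub>, k)" using fh by (simp add: f_def k_def prod_eq_iff)
    then have k: "k \<in> carrier K" using \<theta>.hom_closed[OF in_G] by simp
    have "\<phi> (h, \<one>\<^bsub>K\<^esub>) = \<phi>' (\<theta> (\<phi> (h, \<one>\<^bsub>K\<^esub>)))"
      using \<phi>' in_G by (auto simp: \<theta>_def iso_def bij_betw_inv_into_right)
    also have "\<dots> = \<phi> (\<one>\<^bsub>H\<^esub>, k)" using \<theta>h eq k by simp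
    finally have "(h, \<one>\<^bsub>K\<^esub>) = (\<one>\<^bsub>H\<^esub>, k)"
      using \<phi> h k KH by (auto simp: iso_def bij_betw_def inj_on_def)
    then show ?thesis by simp
  qed
  then have inj: "inj_on f (carrier H)" using f.inj_on_one_iff by blast
  have "f ` carrier H = carrier H'"
    using inj ord H' f_in by (intro card_subset_eq) (auto simp: card_image order_def)
  then have "f \<in> iso H H'" using inj f.homh by (simp add: iso_def bij_betw_def)
  then show ?thesis by (auto simp: is_iso_def)
qed

text \<open>
  The map \<open>H \<mapsto> H \<times> K\<close> lands in the groups with a derived element that is no simple commutator. Its fibre over
  \<open>G\<close> embeds into the homomorphisms from \<open>K\<close> to \<open>G\<close>. For fixed \<open>K\<close> the exponent is linear in \<open>n\<close>, hence
  negligible against a cubic one.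
\<close>
lemma num_all_le_num_derived_not_commutators:
  fixes K :: "'a monoid"
  assumes p: "Factorial_Ring.prime p" and K: "group K" "order K = p ^ k"
    and neq: "derived K (carrier K) \<noteq> simple_commutators K"
  shows "num_all p n \<le> p ^ ((n + k) * (p * k)) * num_derived_not_commutators p (n + k)"
proof -
  let ?bad = "\<lambda>G :: nat monoid. derived G (carrier G) \<noteq> simple_commutators G"
  have p0: "p > 0" using p by (rule prime_gt_0_nat)
  have finK: "finite (carrier K)" using K p0 finite_carrier_of_order[of K] by simp
  obtain R' where R': "iso_transversal (\<lambda>_. True) (p ^ n) R'" using iso_transversal_exists by blast
  obtain R0 where R0: "iso_transversal (\<lambda>_. True) (p ^ (n + k)) R0" using iso_transversal_exists by blast
  obtain R where R: "iso_transversal ?bad (p ^ (n + k)) R" using iso_transversal_exists by blast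
  have finR: "finite R" using card_transversal_mono[OF R0 finite_transversal[OF p R0] R] by blast
  have R'_group: "group H" "order H = p ^ n" "finite (carrier H)" if "H \<in> R'" for H
    using R' that p0 finite_carrier_of_order[of H] by (auto simp: iso_transversal_def groups_of_def)
  have "finite R' \<and> card R' \<le> p ^ ((n + k) * (p * k)) * card R"
  proof (rule card_le_by_fibres[OF finR, where Q = "\<lambda>H G. H \<times>\<times> K \<cong> G"])
    fix H assume H: "H \<in> R'"
    interpret H: group H by (rule R'_group[OF H])
    interpret K: group K by (rule K)
    have grp: "group (H \<times>\<times> K)" by (rule DirProd_group) (rule H.is_group, rule K.is_group)
    have fin: "finite (carrier (H \<times>\<times> K))" using R'_group[OF H] finK by simp
    let ?N = "nat_copy (H \<times>\<times> K)"
    note N = nat_copy[OF grp fin]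
    have "?N \<cong> H \<times>\<times> K" using group.iso_sym[OF grp N(1)] .
    then obtain \<theta> where \<theta>: "\<theta> \<in> iso ?N (H \<times>\<times> K)" by (auto simp: is_iso_def)
    have "snd \<in> hom (H \<times>\<times> K) K" by (auto simp: hom_def DirProd_def)
    moreover have "\<theta> \<in> hom ?N (H \<times>\<times> K)" using \<theta> by (simp add: iso_def)
    ultimately have "snd \<circ> \<theta> \<in> hom ?N K" by (rule hom_compose[rotated])
    then have "group_hom ?N K (snd \<circ> \<theta>)"
      using N(2) K(1) by (simp add: group_hom_def group_hom_axioms_def)
    moreover have "(snd \<circ> \<theta>) ` carrier ?N = carrier K"
    proof -
      have "\<theta> ` carrier ?N = carrier H \<times> carrier K"
        using \<theta> by (simp add: iso_def bij_betw_def DirProd_def)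
      then have "(snd \<circ> \<theta>) ` carrier ?N = snd ` (carrier H \<times> carrier K)" by (simp only: image_comp[symmetric])
      then show ?thesis using H.one_closed by auto
    qed
    ultimately have "?bad ?N" using derived_neq_simple_commutators_lift neq by blast
    moreover have "order ?N = p ^ (n + k)"
      using N(3) R'_group[OF H] K by (simp add: order_def card_cartesian_product power_add)
    ultimately have "?N \<in> groups_of ?bad (p ^ (n + k))" using N(2) by (simp add: groups_of_def)
    then obtain G where "G \<in> R" "?N \<cong> G" using R by (auto simp: iso_transversal_def)
    then show "\<exists>G\<in>R. H \<times>\<times> K \<cong> G" using N(1) iso_trans by blast
  next
    fix G assume G: "G \<in> R"
    then have gG: "group G" and oG: "order G = p ^ (n + k)"
      using R by (auto simp: iso_transversal_def groups_of_def)
    have finG: "finite (carrier G)" using oG p0 finite_carrier_of_order[of G] by simp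
    let ?I = "{H \<in> R'. H \<times>\<times> K \<cong> G}"
    have "\<forall>H\<in>?I. \<exists>f. f \<in> iso (H \<times>\<times> K) G" by (auto simp: is_iso_def)
    from bchoice[OF this] obtain \<phi> where \<phi>: "\<And>H. H \<in> ?I \<Longrightarrow> \<phi> H \<in> iso (H \<times>\<times> K) G"
      by blast
    define c where "c H = restrict (\<lambda>k. \<phi> H (\<one>\<^bsub>H\<^esub>, k)) (carrier K)" for H
    show "finite ?I \<and> card ?I \<le> p ^ ((n + k) * (p * k))"
    proof (rule card_le_by_codes[where f = c and C = "restricted_homs K G"])
      show "inj_on c ?I"
      proof (rule inj_onI)
        fix H H' assume H: "H \<in> ?I" "H' \<in> ?I" "c H = c H'"
        have "\<phi> H (\<one>\<^bsub>H\<^esub>, k) = \<phi> H' (\<one>\<^bsub>H'\<^esub>, k)" if "k \<in> carrier K" for k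
          using fun_cong[OF H(3), of k] that by (simp add: c_def)
        then have "H \<cong> H'"
          using iso_of_product_quotients[OF gG _ _ _ _ K(1) _ \<phi>[OF H(1)] \<phi>[OF H(2)]] R'_group H(1,2) by simp
        then show "H = H'" using R' H by (auto simp: iso_transversal_def)
      qed
      show "c ` ?I \<subseteq> restricted_homs K G"
      proof clarify
        fix H assume H: "H \<in> R'" "H \<times>\<times> K \<cong> G"
        interpret H: group H by (rule R'_group[OF H(1)])
        have iso: "\<phi> H \<in> hom (H \<times>\<times> K) G" using \<phi> H by (auto simp: iso_def)
        have "(\<lambda>k. \<phi> H (\<one>\<^bsub>H\<^esub>, k)) \<in> hom K G"
        proof (rule homI)
          fix x y assume xy: "x \<in> carrier K" "y \<in> carrier K"
          show "\<phi> H (\<one>\<^bsub>H\<^esub>, x) \<in> carrier G" using hom_in_carrier[OF iso] xy by simp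
          show "\<phi> H (\<one>\<^bsub>H\<^esub>, x \<otimes>\<^bsub>K\<^esub> y) = \<phi> H (\<one>\<^bsub>H\<^esub>, x) \<otimes>\<^bsub>G\<^esub> \<phi> H (\<one>\<^bsub>H\<^esub>, y)"
            using hom_mult[OF iso, of "(\<one>\<^bsub>H\<^esub>, x)" "(\<one>\<^bsub>H\<^esub>, y)"] xy by simp
        qed
        then show "c H \<in> restricted_homs K G" by (auto simp: c_def restricted_homs_def)
      qed
      show "finite (restricted_homs K G)" "card (restricted_homs K G) \<le> p ^ ((n + k) * (p * k))"
        using card_restricted_homs[OF K(1) gG finK finG, of "p * k"] prime_power_le_power2[of p k] K(2) oG
        by (auto simp: power_mult[of p "n + k"])
    qed
  qed
  then show ?thesis
    using card_iso_transversal[OF R] card_iso_transversal[OF R']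
    by (simp add: num_all_def num_derived_not_commutators_def)
qed

lemma num_derived_not_commutators_le_num_all:
  assumes p: "Factorial_Ring.prime p"
  shows "num_derived_not_commutators p n \<le> num_all p n"
proof -
  obtain R where R: "iso_transversal (\<lambda>_. True) (p ^ n) R" using iso_transversal_exists by blast
  obtain R' where R': "iso_transversal (\<lambda>G. derived G (carrier G) \<noteq> simple_commutators G) (p ^ n) R'"
    using iso_transversal_exists by blast
  show ?thesis
    using card_transversal_mono[OF R finite_transversal[OF p R] R'] card_iso_transversal[OF R] card_iso_transversal[OF R']
    by (simp add: num_all_def num_derived_not_commutators_def)
qed

section \<open>Groups from bilinear maps\<close>

text \<open>
  The value at coordinate \<open>k\<close> of a bilinear map, with structure constants \<open>c\<close>, in the first \<open>m\<close> coordinates.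
\<close>
definition bilinear_form :: "nat \<Rightarrow> (nat \<Rightarrow> nat \<Rightarrow> nat \<Rightarrow> int) \<Rightarrow> (nat \<Rightarrow> int) \<Rightarrow> (nat \<Rightarrow> int) \<Rightarrow> nat \<Rightarrow> int" where
  "bilinear_form m c x y k = (\<Sum>i<m. \<Sum>j<m. c i j k * x i * y j)"

text \<open>
  Vectors of length \<open>n\<close> modulo \<open>p\<close>, with addition twisted by a bilinear map. If the map takes values in the
  coordinates from \<open>m\<close> on and only reads those below \<open>m\<close>, this is a group of class at most two, a central
  extension of one elementary abelian group by another. Vectors are functions on all naturals that vanish from
  \<open>n\<close> on, so that equality of vectors is equality of functions.
\<close>
definition bilinear_group :: "nat \<Rightarrow> nat \<Rightarrow> nat \<Rightarrow> (nat \<Rightarrow> nat \<Rightarrow> nat \<Rightarrow> int) \<Rightarrow> (nat \<Rightarrow> int) monoid" where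
  "bilinear_group p n m c =
     \<lparr>carrier = {x. (\<forall>k<n. 0 \<le> x k \<and> x k < int p) \<and> (\<forall>k\<ge>n. x k = 0)},
      monoid.mult = (\<lambda>x y k. if k < n then (x k + y k + bilinear_form m c x y k) mod int p else 0),
      one = (\<lambda>_. 0)\<rparr>"

lemma bilinear_form_cong_add_left:
  assumes "\<And>i. i < m \<Longrightarrow> [u i = x i + y i] (mod q)"
  shows "[bilinear_form m c u z k = bilinear_form m c x z k + bilinear_form m c y z k] (mod q)"
proof -
  have "[bilinear_form m c u z k = (\<Sum>i<m. \<Sum>j<m. c i j k * (x i + y i) * z j)] (mod q)"
    unfolding bilinear_form_def using assms by (intro cong_sum cong_mult cong_refl) auto
  then show ?thesis by (simp add: bilinear_form_def algebra_simps sum.distrib)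
qed

lemma bilinear_form_cong_add_right:
  assumes "\<And>i. i < m \<Longrightarrow> [u i = x i + y i] (mod q)"
  shows "[bilinear_form m c z u k = bilinear_form m c z x k + bilinear_form m c z y k] (mod q)"
proof -
  have "[bilinear_form m c z u k = (\<Sum>i<m. \<Sum>j<m. c i j k * z i * (x j + y j))] (mod q)"
    unfolding bilinear_form_def using assms by (intro cong_sum cong_mult cong_refl) auto
  then show ?thesis by (simp add: bilinear_form_def algebra_simps sum.distrib)
qed

lemma bilinear_form_zero [simp]:
  assumes "\<And>i. i < m \<Longrightarrow> x i = 0"
  shows "bilinear_form m c x y k = 0" and "bilinear_form m c y x k = 0"
  using assms by (simp_all add: bilinear_form_def)

definition unit_vector :: "nat \<Rightarrow> nat \<Rightarrow> int" where
  "unit_vector i = (\<lambda>k. if k = i then 1 else 0)"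

lemma bilinear_form_unit_vectors:
  assumes "i < m" "j < m"
  shows "bilinear_form m c (unit_vector i) (unit_vector j) k = c i j k"
proof -
  have "c a b k * unit_vector i a * unit_vector j b
      = (if b = j then if a = i then c i j k else 0 else 0)" for a b
    by (simp add: unit_vector_def)
  then show ?thesis using assms by (simp add: bilinear_form_def sum.delta)
qed

locale bilinear_coefficients =
  fixes p n m :: nat and c :: "nat \<Rightarrow> nat \<Rightarrow> nat \<Rightarrow> int"
  assumes p_gt_1: "p > 1" and mn: "m \<le> n" and coeff_support: "\<And>i j k. k < m \<Longrightarrow> c i j k = 0"
begin

abbreviation "B \<equiv> bilinear_group p n m c"

lemma bilinear_form_low: "k < m \<Longrightarrow> bilinear_form m c x y k = 0"
  by (simp add: bilinear_form_def coeff_support)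

lemma mult_cong: "k < n \<Longrightarrow> [(x \<otimes>\<^bsub>B\<^esub> y) k = x k + y k + bilinear_form m c x y k] (mod int p)"
  by (simp add: bilinear_group_def cong_def)

lemma mult_cong_low: "k < m \<Longrightarrow> [(x \<otimes>\<^bsub>B\<^esub> y) k = x k + y k] (mod int p)"
  using mult_cong[of k x y] mn by (simp add: bilinear_form_low)

lemma mult_closed: "x \<otimes>\<^bsub>B\<^esub> y \<in> carrier B"
  using p_gt_1 by (simp add: bilinear_group_def)

lemma carrier_eqI:
  assumes "x \<in> carrier B" "y \<in> carrier B" "\<And>k. k < n \<Longrightarrow> [x k = y k] (mod int p)"
  shows "x = y"
proof
  fix k
  show "x k = y k"
  proof (cases "k < n")
    case True
    then show ?thesis
      using assms by (intro cong_less_imp_eq_int[of _ "int p"]) (auto simp: bilinear_group_def)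
  next
    case False
    then show ?thesis using assms by (simp add: bilinear_group_def)
  qed
qed

lemma group_bilinear: "group B"
proof (rule groupI)
  show "x \<otimes>\<^bsub>B\<^esub> y \<in> carrier B" for x y by (rule mult_closed)
  show one: "\<one>\<^bsub>B\<^esub> \<in> carrier B" using p_gt_1 by (simp add: bilinear_group_def)
  fix x assume x: "x \<in> carrier B"
  show "\<one>\<^bsub>B\<^esub> \<otimes>\<^bsub>B\<^esub> x = x"
  proof (rule carrier_eqI[OF mult_closed x])
    fix k assume "k < n"
    then show "[(\<one>\<^bsub>B\<^esub> \<otimes>\<^bsub>B\<^esub> x) k = x k] (mod int p)"
      using mult_cong[of k "\<one>\<^bsub>B\<^esub>" x] by (simp add: bilinear_group_def)
  qed
  define y where "y = (\<lambda>k. if k < n then (- x k + bilinear_form m c x x k) mod int p else 0)"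
  have y: "y \<in> carrier B" using p_gt_1 by (simp add: y_def bilinear_group_def)
  have y_cong: "[y k = - x k + bilinear_form m c x x k] (mod int p)" if "k < n" for k
    using that by (simp add: y_def cong_def)
  have "y \<otimes>\<^bsub>B\<^esub> x = \<one>\<^bsub>B\<^esub>"
  proof (rule carrier_eqI[OF mult_closed one])
    fix k assume k: "k < n"
    have y_low: "[0 = y i + x i] (mod int p)" if "i < m" for i
      using cong_sym[OF cong_add[OF y_cong[of i] cong_refl[of "x i"]]] that mn by (simp add: bilinear_form_low)
    have "[0 = bilinear_form m c y x k + bilinear_form m c x x k] (mod int p)"
      using bilinear_form_cong_add_left[of m "\<lambda>_. 0" y x "int p" c x k] y_low by simp
    then have "[bilinear_form m c y x k + bilinear_form m c x x k = 0] (mod int p)" by (rule cong_sym)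
    then have "int p dvd bilinear_form m c y x k + bilinear_form m c x x k" by (simp only: cong_0_iff)
    moreover have "int p dvd y k - (- x k + bilinear_form m c x x k)"
      using y_cong[OF k] by (simp only: cong_iff_dvd_diff)
    ultimately have "int p dvd (bilinear_form m c y x k + bilinear_form m c x x k) +
        (y k - (- x k + bilinear_form m c x x k))"
      by (rule dvd_add)
    then have "[y k + x k + bilinear_form m c y x k = 0] (mod int p)"
      by (simp add: cong_0_iff algebra_simps)
    then show "[(y \<otimes>\<^bsub>B\<^esub> x) k = \<one>\<^bsub>B\<^esub> k] (mod int p)"
      using cong_trans[OF mult_cong[OF k]] by (simp add: bilinear_group_def)
  qed
  then show "\<exists>y\<in>carrier B. y \<otimes>\<^bsub>B\<^esub> x = \<one>\<^bsub>B\<^esub>" using y by blast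
next
  fix x y z
  show "x \<otimes>\<^bsub>B\<^esub> y \<otimes>\<^bsub>B\<^esub> z = x \<otimes>\<^bsub>B\<^esub> (y \<otimes>\<^bsub>B\<^esub> z)"
  proof (rule carrier_eqI[OF mult_closed mult_closed])
    fix k assume k: "k < n"
    let ?f = "\<lambda>x y. bilinear_form m c x y k"
    have "[(x \<otimes>\<^bsub>B\<^esub> y \<otimes>\<^bsub>B\<^esub> z) k = (x \<otimes>\<^bsub>B\<^esub> y) k + z k + ?f (x \<otimes>\<^bsub>B\<^esub> y) z] (mod int p)"
      by (rule mult_cong[OF k])
    also have "[(x \<otimes>\<^bsub>B\<^esub> y) k + z k + ?f (x \<otimes>\<^bsub>B\<^esub> y) z
        = (x k + y k + ?f x y) + z k + (?f x z + ?f y z)] (mod int p)"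
      using mult_cong_low by (intro cong_add mult_cong[OF k] cong_refl bilinear_form_cong_add_left)
    also have "(x k + y k + ?f x y) + z k + (?f x z + ?f y z)
        = x k + (y k + z k + ?f y z) + (?f x y + ?f x z)" by simp
    also have "[x k + (y k + z k + ?f y z) + (?f x y + ?f x z)
        = x k + (y \<otimes>\<^bsub>B\<^esub> z) k + ?f x (y \<otimes>\<^bsub>B\<^esub> z)] (mod int p)"
      using mult_cong_low
      by (intro cong_add cong_refl cong_sym[OF mult_cong[OF k]] cong_sym[OF bilinear_form_cong_add_right])
    also have "[x k + (y \<otimes>\<^bsub>B\<^esub> z) k + ?f x (y \<otimes>\<^bsub>B\<^esub> z) = (x \<otimes>\<^bsub>B\<^esub> (y \<otimes>\<^bsub>B\<^esub> z)) k] (mod int p)"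
      by (rule cong_sym[OF mult_cong[OF k]])
    finally show "[(x \<otimes>\<^bsub>B\<^esub> y \<otimes>\<^bsub>B\<^esub> z) k = (x \<otimes>\<^bsub>B\<^esub> (y \<otimes>\<^bsub>B\<^esub> z)) k] (mod int p)" .
  qed
qed

lemma order_bilinear: "order B = p ^ n"
proof -
  have "bij_betw (\<lambda>x. restrict x {..<n}) (carrier B) ({..<n} \<rightarrow>\<^sub>E {0..<int p})"
  proof (rule bij_betw_byWitness[where f' = "\<lambda>x k. if k < n then x k else 0"])
    show "\<forall>x\<in>carrier B. (\<lambda>k. if k < n then restrict x {..<n} k else 0) = x"
      by (auto simp: bilinear_group_def fun_eq_iff)
    show "\<forall>x\<in>{..<n} \<rightarrow>\<^sub>E {0..<int p}. restrict (\<lambda>k. if k < n then x k else 0) {..<n} = x"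
      by (auto simp: fun_eq_iff PiE_def extensional_def restrict_def)
  qed (auto simp: bilinear_group_def PiE_def Pi_iff)
  then have "order B = card ({..<n} \<rightarrow>\<^sub>E {0..<int p})"
    unfolding order_def by (rule bij_betw_same_card)
  then show ?thesis by (simp add: card_funcsetE)
qed

lemma unit_vector_in_carrier: "i < n \<Longrightarrow> unit_vector i \<in> carrier B"
  using p_gt_1 by (auto simp: bilinear_group_def unit_vector_def)

text \<open>
  Commutators of unit vectors read off the structure constants. The equation \<open>x y = (y x) w\<close> states that \<open>w\<close> is
  the commutator of \<open>x\<close> and \<open>y\<close> without mentioning inverses, which have an unpleasant formula in this group.
\<close>
lemma commutator_unit_vectors:
  assumes "i < m" "j < m" and "\<And>k. c j i k = 0" and w: "\<And>k. k < n \<Longrightarrow> w k = c i j k"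
  shows "unit_vector i \<otimes>\<^bsub>B\<^esub> unit_vector j = (unit_vector j \<otimes>\<^bsub>B\<^esub> unit_vector i) \<otimes>\<^bsub>B\<^esub> w"
proof (rule carrier_eqI[OF mult_closed mult_closed])
  fix k assume k: "k < n"
  let ?e = "unit_vector i" and ?f = "unit_vector j"
  have w_low: "w l = 0" if "l < m" for l using w coeff_support mn that by simp
  have "[(?e \<otimes>\<^bsub>B\<^esub> ?f) k = ?f k + ?e k + w k] (mod int p)"
    using mult_cong[OF k, of ?e ?f] assms k by (simp add: bilinear_form_unit_vectors add.commute)
  also have "[?f k + ?e k + w k = (?f \<otimes>\<^bsub>B\<^esub> ?e) k + w k] (mod int p)"
    using mult_cong[OF k, of ?f ?e] assms(1-3)
    by (intro cong_add cong_refl) (simp add: bilinear_form_unit_vectors cong_sym)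
  also have "[(?f \<otimes>\<^bsub>B\<^esub> ?e) k + w k = ((?f \<otimes>\<^bsub>B\<^esub> ?e) \<otimes>\<^bsub>B\<^esub> w) k] (mod int p)"
    using cong_sym[OF mult_cong[OF k, of "?f \<otimes>\<^bsub>B\<^esub> ?e" w]] w_low by simp
  finally show "[(?e \<otimes>\<^bsub>B\<^esub> ?f) k = (?f \<otimes>\<^bsub>B\<^esub> ?e \<otimes>\<^bsub>B\<^esub> w) k] (mod int p)" .
qed

end

section \<open>A cubic lower bound for the logarithm of the number of groups\<close>

text \<open>
  Coordinates are split into two blocks of length \<open>r\<close> and a rest. The bilinear maps pair the first block with the
  second one and take values in the rest. No constant is attached to a pair in the opposite order, so each constant
  is by itself a coordinate of a commutator.
\<close>
definition coeff_index :: "nat \<Rightarrow> nat \<Rightarrow> (nat \<times> nat \<times> nat) set" where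
  "coeff_index r n = {..<r} \<times> {r..<2 * r} \<times> {2 * r..<n}"

definition coeffs_of :: "nat \<Rightarrow> nat \<Rightarrow> (nat \<times> nat \<times> nat \<Rightarrow> int) \<Rightarrow> nat \<Rightarrow> nat \<Rightarrow> nat \<Rightarrow> int" where
  "coeffs_of r n b i j k = (if (i, j, k) \<in> coeff_index r n then b (i, j, k) else 0)"

text \<open>
  An isomorphism \<open>\<phi>\<close> onto \<open>H\<close> determines the structure constants, and it does so through little data: the images
  of the \<open>2 * r\<close> unit vectors outside the rest, and the restriction of \<open>\<phi>\<close> to the vectors supported on the rest.
  Indeed the former determine the images of the commutators of unit vectors, which are exactly the vectors of
  structure constants, and the latter identifies those vectors from their images.
\<close>
lemma card_bilinear_groups_iso_to:
  assumes p: "p > 1" and rn: "2 * r \<le> n" and H: "group H" "order H = p ^ n"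
  defines "I \<equiv> {b \<in> coeff_index r n \<rightarrow>\<^sub>E {0..<int p}. bilinear_group p n (2 * r) (coeffs_of r n b) \<cong> H}"
  shows "finite I \<and> card I \<le> p ^ (n * (2 * r) + n * (p * n))"
proof -
  let ?m = "2 * r"
  let ?G = "\<lambda>b. bilinear_group p n ?m (coeffs_of r n b)"
  have coeffs: "bilinear_coefficients p n ?m (coeffs_of r n b)" for b
    by standard (use p rn in \<open>auto simp: coeffs_of_def coeff_index_def\<close>)
  have finH: "finite (carrier H)" using H p finite_carrier_of_order[of H] by simp
  have "\<forall>b\<in>I. \<exists>\<phi>. \<phi> \<in> iso (?G b) H" by (auto simp: I_def is_iso_def)
  from bchoice[OF this] obtain \<phi> where \<phi>: "\<And>b. b \<in> I \<Longrightarrow> \<phi> b \<in> iso (?G b) H" by blast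

  \<comment> \<open>The central vectors multiply in the same way for all \<open>b\<close>. They are reached by the homomorphism \<open>\<iota>\<close>, which
     clears the first coordinates, from the elementary abelian group \<open>?A\<close>; its order is exactly \<open>p ^ n\<close>.\<close>
  let ?A = "bilinear_group p n 0 (\<lambda>_ _ _. 0)"
  interpret A: bilinear_coefficients p n 0 "\<lambda>_ _ _. 0" by standard (use p in auto)
  have finA: "finite (carrier ?A)" using A.order_bilinear p finite_carrier_of_order[of ?A] by simp
  define \<iota> :: "(nat \<Rightarrow> int) \<Rightarrow> nat \<Rightarrow> int" where "\<iota> x = (\<lambda>k. if k < ?m then 0 else x k)" for x
  have \<iota>: "\<iota> \<in> hom ?A (?G b)" for b
  proof (rule homI)
    fix x y assume "x \<in> carrier ?A" "y \<in> carrier ?A"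
    show "\<iota> (x \<otimes>\<^bsub>?A\<^esub> y) = \<iota> x \<otimes>\<^bsub>?G b\<^esub> \<iota> y"
    proof
      fix k
      have "bilinear_form ?m (coeffs_of r n b) (\<iota> x) (\<iota> y) k = 0"
        by (rule bilinear_form_zero) (simp add: \<iota>_def)
      moreover have "bilinear_form 0 (\<lambda>_ _ _. 0) x y k = 0" by (rule bilinear_form_zero) simp
      ultimately show "\<iota> (x \<otimes>\<^bsub>?A\<^esub> y) k = (\<iota> x \<otimes>\<^bsub>?G b\<^esub> \<iota> y) k"
        by (simp add: bilinear_group_def) (simp add: \<iota>_def)
    qed
  qed (use p in \<open>auto simp: \<iota>_def bilinear_group_def\<close>)
  define code where "code b = (restrict (\<lambda>i. \<phi> b (unit_vector i)) {..<?m},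
    restrict (\<phi> b \<circ> \<iota>) (carrier ?A))" for b
  interpret H: group H by (rule H(1))
  let ?C = "({..<?m} \<rightarrow>\<^sub>E carrier H) \<times> restricted_homs ?A H"
  show ?thesis
  proof (rule card_le_by_codes[where f = code and C = ?C])
    show "code ` I \<subseteq> ?C"
    proof (rule image_subsetI)
      fix b assume b: "b \<in> I"
      have hom: "\<phi> b \<in> hom (?G b) H" using \<phi>[OF b] by (simp add: iso_def)
      then have "\<phi> b \<circ> \<iota> \<in> hom ?A H" using hom_compose[OF \<iota>] by blast
      moreover have "\<phi> b (unit_vector i) \<in> carrier H" if "i < ?m" for i
        using hom_in_carrier[OF hom] bilinear_coefficients.unit_vector_in_carrier[OF coeffs] that rn by simp
      ultimately show "code b \<in> ?C" by (auto simp: code_def restricted_homs_def)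
    qed
    show "inj_on code I"
    proof (rule inj_onI)
      fix b b' assume b: "b \<in> I" and b': "b' \<in> I" and eq: "code b = code b'"
      have eq_unit: "\<phi> b (unit_vector i) = \<phi> b' (unit_vector i)" if "i < ?m" for i
        using fun_cong[OF arg_cong[OF eq, of fst], of i] that by (simp add: code_def)
      have eq_\<iota>: "\<phi> b (\<iota> x) = \<phi> b' (\<iota> x)" if "x \<in> carrier ?A" for x
        using fun_cong[OF arg_cong[OF eq, of snd], of x] that by (simp add: code_def)
      have "coeffs_of r n b i j k = coeffs_of r n b' i j k" if i: "i < r" and j: "r \<le> j" "j < ?m" for i j k
      proof -
        let ?w = "\<lambda>b. coeffs_of r n b i j"
        have w_in: "?w a \<in> carrier ?A" "\<iota> (?w a) = ?w a" if "a \<in> I" for a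
        proof -
          show "\<iota> (?w a) = ?w a" by (auto simp: \<iota>_def coeffs_of_def coeff_index_def)
          have "a t \<in> {0..<int p}" if "t \<in> coeff_index r n" for t
            using \<open>a \<in> I\<close> that by (auto simp: I_def)
          then show "?w a \<in> carrier ?A"
            using p by (auto simp: bilinear_group_def coeffs_of_def) (auto simp: coeff_index_def)
        qed
        \<comment> \<open>\<open>?w a\<close> is the commutator of the two unit vectors in the group belonging to \<open>a\<close>\<close>
        have comm: "\<phi> a (unit_vector i) \<otimes>\<^bsub>H\<^esub> \<phi> a (unit_vector j)
            = (\<phi> a (unit_vector j) \<otimes>\<^bsub>H\<^esub> \<phi> a (unit_vector i)) \<otimes>\<^bsub>H\<^esub> \<phi> a (?w a)"
          and in_H: "\<phi> a (unit_vector i) \<in> carrier H" "\<phi> a (unit_vector j) \<in> carrier H" "\<phi> a (?w a) \<in> carrier H"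
          if a: "a \<in> I" for a
        proof -
          interpret a: bilinear_coefficients p n ?m "coeffs_of r n a" by (rule coeffs)
          have hom: "\<phi> a \<in> hom (?G a) H" using \<phi>[OF a] by (simp add: iso_def)
          have e: "unit_vector i \<in> carrier (?G a)" "unit_vector j \<in> carrier (?G a)"
            using a.unit_vector_in_carrier i j rn by auto
          have w: "?w a \<in> carrier (?G a)" using hom_in_carrier[OF \<iota> w_in(1)[OF a]] w_in(2)[OF a] by simp
          show "\<phi> a (unit_vector i) \<in> carrier H" "\<phi> a (unit_vector j) \<in> carrier H" "\<phi> a (?w a) \<in> carrier H"
            using hom_in_carrier[OF hom] e w by auto
          have "unit_vector i \<otimes>\<^bsub>?G a\<^esub> unit_vector j = (unit_vector j \<otimes>\<^bsub>?G a\<^esub> unit_vector i) \<otimes>\<^bsub>?G a\<^esub> ?w a"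
            by (rule a.commutator_unit_vectors) (use i j in \<open>auto simp: coeffs_of_def coeff_index_def\<close>)
          from arg_cong[OF this, of "\<phi> a"]
          show "\<phi> a (unit_vector i) \<otimes>\<^bsub>H\<^esub> \<phi> a (unit_vector j)
              = (\<phi> a (unit_vector j) \<otimes>\<^bsub>H\<^esub> \<phi> a (unit_vector i)) \<otimes>\<^bsub>H\<^esub> \<phi> a (?w a)"
            by (simp only: hom_mult[OF hom] e w a.mult_closed)
        qed
        have "(\<phi> b (unit_vector j) \<otimes>\<^bsub>H\<^esub> \<phi> b (unit_vector i)) \<otimes>\<^bsub>H\<^esub> \<phi> b (?w b)
            = (\<phi> b (unit_vector j) \<otimes>\<^bsub>H\<^esub> \<phi> b (unit_vector i)) \<otimes>\<^bsub>H\<^esub> \<phi> b' (?w b')"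
          using comm[OF b] comm[OF b'] eq_unit[of i] eq_unit[of j] i j by simp
        then have "\<phi> b (?w b) = \<phi> b' (?w b')"
          using in_H[OF b] in_H(3)[OF b'] by simp
        also have "\<dots> = \<phi> b (?w b')" using eq_\<iota>[OF w_in(1)[OF b']] w_in(2)[OF b'] by simp
        finally have \<phi>w: "\<phi> b (?w b) = \<phi> b (?w b')" .
        have inj: "inj_on (\<phi> b) (carrier (?G b))" using \<phi>[OF b] by (simp add: iso_def bij_betw_def)
        have "?w a \<in> carrier (?G b)" if "a \<in> I" for a
          using hom_in_carrier[OF \<iota> w_in(1)[OF that]] w_in(2)[OF that] by simp
        then have "?w b = ?w b'" using inj \<phi>w b b' by (simp add: inj_on_def)
        then show ?thesis by (rule fun_cong)
      qed
      note coeffs_eq = this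
      have "b t = b' t" if t: "t \<in> coeff_index r n" for t
      proof -
        obtain i j k where ijk: "t = (i, j, k)" by (cases t)
        then have "i < r" "r \<le> j" "j < ?m" using t by (auto simp: coeff_index_def)
        from coeffs_eq[OF this, of k] show ?thesis using t by (simp add: ijk coeffs_of_def)
      qed
      moreover have "b \<in> coeff_index r n \<rightarrow>\<^sub>E {0..<int p}" "b' \<in> coeff_index r n \<rightarrow>\<^sub>E {0..<int p}"
        using b b' by (simp_all add: I_def)
      ultimately show "b = b'" using PiE_ext by blast
    qed
    have homs: "finite (restricted_homs ?A H)" "card (restricted_homs ?A H) \<le> (p ^ n) ^ (p * n)"
      using card_restricted_homs[OF A.group_bilinear H(1) finA finH, of "p * n"]
        prime_power_le_power2[of p n] A.order_bilinear H(2) by auto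
    show "finite ?C" using homs finH by (simp add: finite_PiE)
    have "card ?C \<le> (p ^ n) ^ ?m * (p ^ n) ^ (p * n)"
      using homs H(2) by (simp add: card_cartesian_product card_funcsetE order_def)
    then show "card ?C \<le> p ^ (n * (2 * r) + n * (p * n))"
      by (simp only: power_add power_mult)
  qed
qed

text \<open>
  With \<open>r\<close> about \<open>n / 3\<close> the exponent on the left is cubic in \<open>n\<close>, while the one on the right is quadratic.
\<close>
lemma power_le_num_all:
  assumes p: "Factorial_Ring.prime p" and rn: "2 * r \<le> n"
  shows "p ^ (r * r * (n - 2 * r)) \<le> p ^ (n * (2 * r) + n * (p * n)) * num_all p n"
proof -
  have p1: "p > 1" using p by (rule prime_gt_1_nat)
  obtain R where R: "iso_transversal (\<lambda>_. True) (p ^ n) R" using iso_transversal_exists by blast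
  let ?I = "coeff_index r n \<rightarrow>\<^sub>E {0..<int p}"
  let ?G = "\<lambda>b. bilinear_group p n (2 * r) (coeffs_of r n b)"
  have "finite ?I \<and> card ?I \<le> p ^ (n * (2 * r) + n * (p * n)) * card R"
  proof (rule card_le_by_fibres[OF finite_transversal[OF p R], where Q = "\<lambda>b H. ?G b \<cong> H"])
    fix b
    interpret b: bilinear_coefficients p n "2 * r" "coeffs_of r n b"
      by standard (use p1 rn in \<open>auto simp: coeffs_of_def coeff_index_def\<close>)
    have fin: "finite (carrier (?G b))"
      using b.order_bilinear p1 finite_carrier_of_order[of "?G b"] by simp
    note N = nat_copy[OF b.group_bilinear fin]
    have "nat_copy (?G b) \<in> groups_of (\<lambda>_. True) (p ^ n)"
      using N b.order_bilinear by (simp add: groups_of_def)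
    then obtain H where "H \<in> R" "nat_copy (?G b) \<cong> H" using R by (auto simp: iso_transversal_def)
    then show "\<exists>H\<in>R. ?G b \<cong> H" using iso_trans[OF N(1)] by blast
  next
    fix H assume "H \<in> R"
    then have "group H" "order H = p ^ n" using R by (auto simp: iso_transversal_def groups_of_def)
    then show "finite {b \<in> ?I. ?G b \<cong> H} \<and> card {b \<in> ?I. ?G b \<cong> H} \<le> p ^ (n * (2 * r) + n * (p * n))"
      by (rule card_bilinear_groups_iso_to[OF p1 rn])
  qed
  moreover have "card ?I = p ^ (r * r * (n - 2 * r))"
    by (simp add: coeff_index_def card_funcsetE card_cartesian_product mult.assoc)
  ultimately show ?thesis using card_iso_transversal[OF R] by (simp add: num_all_def)
qed

section \<open>A group whose derived subgroup has an element that is no simple commutator\<close>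

text \<open>
  Coordinates \<open>4, ..., 9\<close> stand for the six pairs \<open>i < j\<close> of coordinates below \<open>4\<close>. The commutator of \<open>x\<close> and \<open>y\<close>
  then consists of the six minors \<open>x i * y j - x j * y i\<close>, that is, of the Pluecker coordinates of \<open>x \<and> y\<close>.
\<close>
definition pluecker_coeffs :: "nat \<Rightarrow> nat \<Rightarrow> nat \<Rightarrow> int" where
  "pluecker_coeffs i j k =
     (if (i, j, k) \<in> {(0, 1, 4), (0, 2, 5), (0, 3, 6), (1, 2, 7), (1, 3, 8), (2, 3, 9)} then 1 else 0)"

abbreviation pluecker_group :: "nat \<Rightarrow> (nat \<Rightarrow> int) monoid" where
  "pluecker_group p \<equiv> bilinear_group p 10 4 pluecker_coeffs"

lemma pluecker_form:
  "bilinear_form 4 pluecker_coeffs x y 4 = x 0 * y 1"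
  "bilinear_form 4 pluecker_coeffs x y 5 = x 0 * y 2"
  "bilinear_form 4 pluecker_coeffs x y 6 = x 0 * y 3"
  "bilinear_form 4 pluecker_coeffs x y 7 = x 1 * y 2"
  "bilinear_form 4 pluecker_coeffs x y 8 = x 1 * y 3"
  "bilinear_form 4 pluecker_coeffs x y 9 = x 2 * y 3"
  by (simp_all add: bilinear_form_def pluecker_coeffs_def eval_nat_numeral)

lemma pluecker_coefficients: "p > 1 \<Longrightarrow> bilinear_coefficients p 10 4 pluecker_coeffs"
  by standard (auto simp: pluecker_coeffs_def)

lemma (in group) simple_commutator_iff:
  "z \<in> simple_commutators G \<longleftrightarrow>
     z \<in> carrier G \<and> (\<exists>g\<in>carrier G. \<exists>h\<in>carrier G. g \<otimes> h = (h \<otimes> g) \<otimes> z)"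
proof
  assume "z \<in> simple_commutators G"
  then obtain g h where gh: "g \<in> carrier G" "h \<in> carrier G" and z: "z = inv g \<otimes> inv h \<otimes> g \<otimes> h"
    by (auto simp: simple_commutators_def)
  have "z = inv (h \<otimes> g) \<otimes> (g \<otimes> h)" using gh by (simp add: z inv_mult_group m_assoc)
  then have "(h \<otimes> g) \<otimes> z = g \<otimes> h" using gh by (simp add: m_assoc[symmetric])
  then show "z \<in> carrier G \<and> (\<exists>g\<in>carrier G. \<exists>h\<in>carrier G. g \<otimes> h = (h \<otimes> g) \<otimes> z)"
    using gh by (intro conjI bexI[of _ g] bexI[of _ h]) (simp_all add: z)
next
  assume "z \<in> carrier G \<and> (\<exists>g\<in>carrier G. \<exists>h\<in>carrier G. g \<otimes> h = (h \<otimes> g) \<otimes> z)"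
  then obtain g h where z: "z \<in> carrier G" and gh: "g \<in> carrier G" "h \<in> carrier G"
    and eq: "g \<otimes> h = (h \<otimes> g) \<otimes> z" by blast
  have "z = inv (h \<otimes> g) \<otimes> (g \<otimes> h)" using gh z eq by (simp add: inv_solve_left)
  then have "z = inv g \<otimes> inv h \<otimes> g \<otimes> h" using gh by (simp add: inv_mult_group m_assoc)
  then show "z \<in> simple_commutators G" using gh by (auto simp: simple_commutators_def)
qed

text \<open>
  The Pluecker relation, which distinguishes the pure wedges \<open>x \<and> y\<close> among the vectors of the exterior square.
\<close>
lemma pluecker_relation:
  assumes p: "p > 1" and z: "z \<in> simple_commutators (pluecker_group p)"
  shows "[z 4 * z 9 - z 5 * z 8 + z 6 * z 7 = 0] (mod int p)"
proof -
  interpret bilinear_coefficients p 10 4 pluecker_coeffs by (rule pluecker_coefficients[OF p])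
  let ?f = "\<lambda>x y k. bilinear_form 4 pluecker_coeffs x y k"
  obtain g h where z_in: "z \<in> carrier B" and eq: "g \<otimes>\<^bsub>B\<^esub> h = (h \<otimes>\<^bsub>B\<^esub> g) \<otimes>\<^bsub>B\<^esub> z"
    using z group.simple_commutator_iff[OF group_bilinear] by blast
  have total: "[g k + h k + ?f g h k = h k + g k + ?f h g k + z k + ?f (h \<otimes>\<^bsub>B\<^esub> g) z k] (mod int p)"
    if k: "k < 10" for k
  proof -
    have "[g k + h k + ?f g h k = (g \<otimes>\<^bsub>B\<^esub> h) k] (mod int p)" by (rule cong_sym[OF mult_cong[OF k]])
    also have "[(g \<otimes>\<^bsub>B\<^esub> h) k = (h \<otimes>\<^bsub>B\<^esub> g) k + z k + ?f (h \<otimes>\<^bsub>B\<^esub> g) z k] (mod int p)"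
      unfolding eq by (rule mult_cong[OF k])
    also have "[(h \<otimes>\<^bsub>B\<^esub> g) k + z k + ?f (h \<otimes>\<^bsub>B\<^esub> g) z k
        = (h k + g k + ?f h g k) + z k + ?f (h \<otimes>\<^bsub>B\<^esub> g) z k] (mod int p)"
      by (intro cong_add cong_refl mult_cong[OF k])
    finally show ?thesis by simp
  qed
  have z_low: "z k = 0" if "k < 4" for k
  proof -
    have "[0 = z k] (mod int p)"
      using total[of k] that by (simp add: bilinear_form_low cong_iff_dvd_diff)
    then show ?thesis using z_in that cong_less_imp_eq_int[of 0 "int p" "z k"] p
      by (simp add: bilinear_group_def)
  qed
  have "[z k = ?f g h k - ?f h g k] (mod int p)" if "k < 10" for k
    using cong_sym[OF total[OF that]] z_low by (simp add: cong_iff_dvd_diff algebra_simps)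
  note zk = this
  have "[z 4 * z 9 - z 5 * z 8 + z 6 * z 7
      = (?f g h 4 - ?f h g 4) * (?f g h 9 - ?f h g 9) - (?f g h 5 - ?f h g 5) * (?f g h 8 - ?f h g 8)
        + (?f g h 6 - ?f h g 6) * (?f g h 7 - ?f h g 7)] (mod int p)"
    by (intro cong_add cong_diff cong_mult zk) simp_all
  also have "(?f g h 4 - ?f h g 4) * (?f g h 9 - ?f h g 9) - (?f g h 5 - ?f h g 5) * (?f g h 8 - ?f h g 8)
        + (?f g h 6 - ?f h g 6) * (?f g h 7 - ?f h g 7) = 0"
    unfolding pluecker_form by (simp add: algebra_simps)
  finally show ?thesis .
qed

text \<open>
  The product of the commutators \<open>e 0 \<and> e 1\<close> and \<open>e 2 \<and> e 3\<close> is the standard example of a vector that is no pure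
  wedge: only its coordinates \<open>4\<close> and \<open>9\<close> are nonzero, so it violates the Pluecker relation.
\<close>
lemma pluecker_group_derived_neq:
  assumes p: "p > 1"
  shows "derived (pluecker_group p) (carrier (pluecker_group p)) \<noteq> simple_commutators (pluecker_group p)"
proof
  interpret bilinear_coefficients p 10 4 pluecker_coeffs by (rule pluecker_coefficients[OF p])
  assume eq: "derived B (carrier B) = simple_commutators B"
  have comm: "unit_vector k \<in> simple_commutators B"
    if "(i, j, k) \<in> {(0, 1, 4), (2, 3, 9)}" for i j k :: nat
  proof -
    have ijk: "i = 0 \<and> j = 1 \<and> k = 4 \<or> i = 2 \<and> j = 3 \<and> k = 9" using that by simp
    have "unit_vector i \<otimes>\<^bsub>B\<^esub> unit_vector j = (unit_vector j \<otimes>\<^bsub>B\<^esub> unit_vector i) \<otimes>\<^bsub>B\<^esub> unit_vector k"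
    proof (rule commutator_unit_vectors)
      show "i < 4" "j < 4" using ijk by auto
      show "pluecker_coeffs j i l = 0" for l
        using ijk by (elim disjE conjE; simp add: pluecker_coeffs_def)
      show "unit_vector k l = pluecker_coeffs i j l" for l
        using ijk by (elim disjE conjE; simp add: pluecker_coeffs_def unit_vector_def)
    qed
    moreover have "unit_vector i \<in> carrier B" "unit_vector j \<in> carrier B" "unit_vector k \<in> carrier B"
      using ijk by (auto intro: unit_vector_in_carrier)
    ultimately show ?thesis
      unfolding group.simple_commutator_iff[OF group_bilinear] by blast
  qed
  let ?z = "unit_vector 4 \<otimes>\<^bsub>B\<^esub> unit_vector 9"
  have "?z \<in> generate B (simple_commutators B)"
    using comm[of 0 1 4] comm[of 2 3 9] by (intro generate.eng generate.incl) auto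
  then have "?z \<in> simple_commutators B"
    using eq group.derived_eq_generate_simple_commutators[OF group_bilinear] by simp
  then have "[?z 4 * ?z 9 - ?z 5 * ?z 8 + ?z 6 * ?z 7 = 0] (mod int p)" by (rule pluecker_relation[OF p])
  moreover have "?z k = (if k = 4 \<or> k = 9 then 1 else 0)" for k
  proof -
    have "bilinear_form 4 pluecker_coeffs (unit_vector 4) (unit_vector 9) k = 0"
      by (rule bilinear_form_zero) (simp add: unit_vector_def)
    then show ?thesis using p by (simp add: bilinear_group_def) (simp add: unit_vector_def)
  qed
  ultimately show False using p by (simp add: cong_0_iff)
qed

section \<open>The limit\<close>

lemma log_le_exponent_plus_log:
  fixes p a b :: nat
  assumes "p > 1" and "a > 0" and "a \<le> p ^ e * b"
  shows "b > 0" and "log p a \<le> e + log p b"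
proof -
  show b: "b > 0" using assms(2,3) by (cases "b = 0") auto
  have "real a \<le> real p ^ e * real b"
    using assms(3) by (metis of_nat_le_iff of_nat_mult of_nat_power)
  then have "log p a \<le> log p (real p ^ e * real b)"
    using assms b by (intro log_mono) auto
  also have "\<dots> = e + log p b"
    using assms(1) b by (simp add: log_mult log_nat_power)
  finally show "log p a \<le> e + log p b" .
qed

lemma num_all_pos:
  assumes "Factorial_Ring.prime p"
  shows "num_all p n > 0"
  using power_le_num_all[OF assms, of 0 n] by (cases "num_all p n = 0") auto

lemma log_num_all_add_le:
  assumes p: "Factorial_Ring.prime p"
  shows "log p (num_all p (n + k)) \<le> log p (num_all p n) + k * ((real p + 1) * (n + k)\<^sup>2)"
proof (induction k)
  case (Suc k)
  have p1: "p > 1" using p by (rule prime_gt_1_nat)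
  let ?N = "real (n + k)"
  have "log p (num_all p (Suc (n + k)))
      \<le> real ((n + k) * (p * (n + k)) + (n + k)) + log p (num_all p (n + k))"
    by (rule log_le_exponent_plus_log(2)[OF p1 num_all_pos[OF p] num_all_Suc_le[OF p]])
  moreover have "real ((n + k) * (p * (n + k)) + (n + k)) \<le> (real p + 1) * (?N + 1)\<^sup>2"
  proof -
    have "?N * (real p * ?N) + ?N = real p * ?N\<^sup>2 + ?N" by (simp add: power2_eq_square)
    also have "\<dots> \<le> real p * (?N + 1)\<^sup>2 + (?N + 1)\<^sup>2"
      by (intro add_mono mult_left_mono power_mono) (auto simp: power2_eq_square algebra_simps)
    finally show ?thesis by (simp add: algebra_simps)
  qed
  moreover have "k * ((real p + 1) * ?N\<^sup>2) \<le> k * ((real p + 1) * (?N + 1)\<^sup>2)"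
    by (intro mult_left_mono power_mono) auto
  ultimately show ?case using Suc by (simp add: algebra_simps)
qed simp

lemma log_num_all_lower_bound:
  assumes p: "Factorial_Ring.prime p"
  shows "(n / 3 - 1) ^ 3 - (real p + 1) * (real n)\<^sup>2 \<le> log p (num_all p n)"
proof -
  have p1: "p > 1" using p by (rule prime_gt_1_nat)
  define r where "r = n div 3"
  have rn: "2 * r \<le> n" "r \<le> n - 2 * r" by (auto simp: r_def)
  have "log p (p ^ (r * r * (n - 2 * r)) :: nat)
      \<le> real (n * (2 * r) + n * (p * n)) + log p (num_all p n)"
    by (rule log_le_exponent_plus_log(2)[OF p1 _ power_le_num_all[OF p rn(1)]]) (use p1 in simp)
  then have main: "real (r * r * (n - 2 * r)) \<le> real (n * (2 * r) + n * (p * n)) + log p (num_all p n)"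
    using p1 by (simp add: log_nat_power)
  have "r ^ 3 \<le> r * r * (n - 2 * r)" using rn(2) by (simp add: power3_eq_cube)
  moreover have "n * (2 * r) + n * (p * n) \<le> (p + 1) * n\<^sup>2"
    using mult_le_mono2[OF rn(1), of n] by (simp add: power2_eq_square algebra_simps)
  ultimately have "real (r ^ 3) \<le> real ((p + 1) * n\<^sup>2) + log p (num_all p n)"
    using main by (smt (verit) of_nat_le_iff)
  moreover have "(n / 3 - 1) ^ 3 \<le> real r ^ 3"
  proof -
    have "real n \<le> 3 * real r + 3"
      unfolding r_def by linarith
    then show ?thesis by (intro power_mono_odd) auto
  qed
  ultimately show ?thesis by (simp add: algebra_simps)
qed

text \<open>
  The group of order \<open>p ^ 10\<close> from the Pluecker relation embeds the groups of order \<open>p ^ (n - 10)\<close> into the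
  exceptional ones of order \<open>p ^ n\<close>, and going back from \<open>n - 10\<close> to \<open>n\<close> in the number of all groups costs ten
  extension steps. Each of the two losses is at most \<open>10 (p + 1) n\<^sup>2\<close>.
\<close>
lemma log_num_derived_not_commutators_lower_bound:
  assumes p: "Factorial_Ring.prime p" and n: "n \<ge> 10"
  shows "num_derived_not_commutators p n > 0"
    and "log p (num_all p n) - 20 * (real p + 1) * (real n)\<^sup>2 \<le> log p (num_derived_not_commutators p n)"
proof -
  have p1: "p > 1" using p by (rule prime_gt_1_nat)
  interpret bilinear_coefficients p 10 4 pluecker_coeffs by (rule pluecker_coefficients[OF p1])
  define m where "m = n - 10"
  have nm: "n = m + 10" using n by (simp add: m_def)
  have le: "num_all p m \<le> p ^ (n * (p * 10)) * num_derived_not_commutators p n"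
    unfolding nm by (rule num_all_le_num_derived_not_commutators[OF p group_bilinear order_bilinear
          pluecker_group_derived_neq[OF p1]])
  show "num_derived_not_commutators p n > 0"
    by (rule log_le_exponent_plus_log(1)[OF p1 num_all_pos[OF p] le])
  have "log p (num_all p m) \<le> n * (p * 10) + log p (num_derived_not_commutators p n)"
    by (rule log_le_exponent_plus_log(2)[OF p1 num_all_pos[OF p] le])
  moreover have "log p (num_all p n) \<le> log p (num_all p m) + 10 * ((real p + 1) * (real n)\<^sup>2)"
    using log_num_all_add_le[OF p, of m 10] by (simp add: nm)
  moreover have "real (n * (p * 10)) \<le> 10 * ((real p + 1) * (real n)\<^sup>2)"
  proof -
    have "real n * real p \<le> (real n)\<^sup>2 * (real p + 1)"
      using n by (intro mult_mono) (auto simp: power2_eq_square)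
    then show ?thesis by (simp add: algebra_simps)
  qed
  ultimately show "log p (num_all p n) - 20 * (real p + 1) * (real n)\<^sup>2
      \<le> log p (num_derived_not_commutators p n)"
    by (simp add: algebra_simps)
qed

theorem proposition5p9p1:
  fixes p :: nat
  assumes "Factorial_Ring.prime p" and "p > 2"
  shows "(\<lambda>n. log (real p) (real (num_derived_not_commutators p n)) / log (real p) (real (num_all p n)))
           \<longlonglongrightarrow> 1"
proof -
  have p: "Factorial_Ring.prime p" by (rule assms(1))
  then have p1: "p > 1" by (rule prime_gt_1_nat)
  define a where "a n = log p (num_all p n)" for n
  define b where "b n = log p (num_derived_not_commutators p n)" for n
  define C where "C = 20 * (real p + 1)"
  define l where "l n = (real n / 3 - 1) ^ 3 - (real p + 1) * (real n)\<^sup>2" for n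
  have C0: "C > 0" by (simp add: C_def)
  have l_le: "l n \<le> a n" for n
    using log_num_all_lower_bound[OF p] by (simp add: a_def l_def)
  have l_pos: "eventually (\<lambda>n. l n > 0) sequentially"
    unfolding l_def by real_asymp
  have lim: "(\<lambda>n. 1 - C * (real n)\<^sup>2 / l n) \<longlonglongrightarrow> 1"
    unfolding l_def by real_asymp
  have "(\<lambda>n. b n / a n) \<longlonglongrightarrow> 1"
  proof (rule tendsto_sandwich[OF _ _ lim tendsto_const])
    show "eventually (\<lambda>n. 1 - C * (real n)\<^sup>2 / l n \<le> b n / a n) sequentially"
      using l_pos eventually_ge_at_top[of 10]
    proof eventually_elim
      case (elim n)
      then have a0: "a n > 0" using l_le[of n] by linarith
      have "1 - C * (real n)\<^sup>2 / l n \<le> 1 - C * (real n)\<^sup>2 / a n"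
        using l_le[of n] elim a0 C0 by (intro diff_left_mono divide_left_mono) auto
      also have "\<dots> = (a n - C * (real n)\<^sup>2) / a n" using a0 by (simp add: field_simps)
      also have "\<dots> \<le> b n / a n"
        using log_num_derived_not_commutators_lower_bound(2)[OF p elim(2)] a0
        by (intro divide_right_mono) (auto simp: a_def b_def C_def)
      finally show ?case .
    qed
    show "eventually (\<lambda>n. b n / a n \<le> 1) sequentially"
      using l_pos eventually_ge_at_top[of 10]
    proof eventually_elim
      case (elim n)
      then have a0: "a n > 0" using l_le[of n] by linarith
      have "b n \<le> a n"
        unfolding a_def b_def
        using p1 log_num_derived_not_commutators_lower_bound(1)[OF p elim(2)]
          num_derived_not_commutators_le_num_all[OF p, of n] by (intro log_mono) auto
      then show ?case using a0 by simp
    qed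
  qed
  then show ?thesis by (simp add: a_def b_def)
qed

end
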